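(* Let $X=(X_t)_{t\in T}$ be an infinitely divisible process having a $\sigma$-finite Lévy measure $\nu$. Let $Z=(Z_t)_{t\in T}$ be a process independent of $X$ such that $\mathcal{L}(Z)\ll\nu$. Then $\mathcal{L}(X+Z)\ll\mathcal{L}(X)$. Hence, there exists a measurable functional $g:\mathbb{R}^T\to\mathbb{R}_+$ such that for any measurable functional $F:\mathbb{R}^T\to\mathbb{R}$ $$\mathbb{E}\,F\big((X_t+Z_t)_{t\in T}\big)=\mathbb{E}\big[F\big((X_t)_{t\in T}\big)\,g(X)\big].$$
   Context: $T$ is an arbitrary nonempty set, $\mathbb{R}^T$ the space of all functions $x:T\to\mathbb{R}$, $\mathcal{B}^T$ its cylindrical (product) $\sigma$-algebra. $\mathcal{L}(Z)$ denotes the law of the process $Z$ on $(\mathbb{R}^T,\mathcal{B}^T)$, and $\ll$ denotes absolute continuity. An identity between expectations reads: if one side exists then the other does and they are equal. A measure $\nu$ on $(\mathbb{R}^T,\mathcal{B}^T)$ is a Lévy measure if (L1) $\int|x(t)|^2\wedge1\,\nu(dx)<\infty$ for every $t\in T$, and (L2) $\nu(A)=\nu_*(A\setminus\{0_T\})$ for every $A\in\mathcal{B}^T$, where $0_T$ is the zero function and $\nu_*(E)=\sup\{\nu(D):D\subset E,\ D\in\mathcal{B}^T\}$. A process $X$ is infinitely divisible if all its finite-dimensional distributions are. Its Lévy measure is the unique Lévy measure $\nu$ on $(\mathbb{R}^T,\mathcal{B}^T)$ such that, for a (symmetric) non-negative definite $\Sigma$ on $T\times T$, some $b\in\mathbb{R}^T$,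 all finite nonempty $I\subset T$ and $a\in\mathbb{R}^I$, $$\mathbb{E}e^{i\sum_{t\in I}a_tX_t}=\exp\Big\{-\tfrac12\sum_{s,t\in I}a_sa_t\Sigma(s,t)+\int_{\mathbb{R}^T}\Big(e^{i\sum_{t\in I}a_tx(t)}-1-i\sum_{t\in I}a_tx(t)\mathbf{1}_{\{|x(t)|\le1\}}\Big)\nu(dx)+i\sum_{t\in I}a_tb(t)\Big\}.$$ *)

theory Defs
  imports "HOL-Probability.Probability"
begin

text \<open>
  The index set \<open>T\<close> is the type \<open>'t\<close>, so the function space over \<open>T\<close> is the type
  \<open>'t \<Rightarrow> real\<close>.  Its cylindrical sigma-algebra is the product sigma-algebra; for
  uncountable \<open>'t\<close> this differs from \<open>borel\<close> on the function type.
\<close>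

abbreviation cylindrical :: "('t \<Rightarrow> real) measure" where
  "cylindrical \<equiv> PiM UNIV (\<lambda>_. borel)"

definition sample_path :: "('t \<Rightarrow> 'w \<Rightarrow> real) \<Rightarrow> 'w \<Rightarrow> ('t \<Rightarrow> real)" where
  "sample_path X \<omega> = (\<lambda>t. X t \<omega>)"

definition process :: "'w measure \<Rightarrow> ('t \<Rightarrow> 'w \<Rightarrow> real) \<Rightarrow> bool" where
  "process M X \<longleftrightarrow> (\<forall>t. X t \<in> borel_measurable M)"

definition law :: "'w measure \<Rightarrow> ('t \<Rightarrow> 'w \<Rightarrow> real) \<Rightarrow> ('t \<Rightarrow> real) measure" where
  "law M X = distr M cylindrical (sample_path X)"

definition fdd :: "'w measure \<Rightarrow> ('t \<Rightarrow> 'w \<Rightarrow> real) \<Rightarrow> 't set \<Rightarrow> ('t \<Rightarrow> real) measure" where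
  "fdd M X I = distr M (PiM I (\<lambda>_. borel)) (\<lambda>\<omega>. \<lambda>t\<in>I. X t \<omega>)"

text \<open>
  A law on the coordinates in \<open>I\<close> is infinitely divisible if for every \<open>n \<ge> 1\<close> it is the
  law of a sum of \<open>n\<close> independent vectors with a common law \<open>\<rho>\<close>.
\<close>

definition infinitely_divisible_on :: "'t set \<Rightarrow> ('t \<Rightarrow> real) measure \<Rightarrow> bool" where
  "infinitely_divisible_on I \<mu> \<longleftrightarrow>
    (\<forall>n::nat. n \<ge> 1 \<longrightarrow>
      (\<exists>\<rho>. prob_space \<rho> \<and> sets \<rho> = sets (PiM I (\<lambda>_. borel)) \<and>
        \<mu> = distr (PiM {..<n} (\<lambda>_. \<rho>)) (PiM I (\<lambda>_. borel)) (\<lambda>y. \<lambda>t\<in>I. \<Sum>k<n. y k t)))"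

definition infinitely_divisible_process :: "'w measure \<Rightarrow> ('t \<Rightarrow> 'w \<Rightarrow> real) \<Rightarrow> bool" where
  "infinitely_divisible_process M X \<longleftrightarrow>
    process M X \<and> (\<forall>I. finite I \<and> I \<noteq> {} \<longrightarrow> infinitely_divisible_on I (fdd M X I))"

definition inner_measure :: "'a measure \<Rightarrow> 'a set \<Rightarrow> ennreal" where
  "inner_measure \<nu> E = (SUP D \<in> {D \<in> sets \<nu>. D \<subseteq> E}. emeasure \<nu> D)"

text \<open>
  For uncountable \<open>'t\<close> the singleton of the zero function is not in the cylindrical
  sigma-algebra, hence the inner measure in the second condition.
\<close>

definition levy_measure :: "('t \<Rightarrow> real) measure \<Rightarrow> bool" where
  "levy_measure \<nu> \<longleftrightarrow>
    sets \<nu> = sets cylindrical \<and>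
    (\<forall>t. (\<integral>\<^sup>+ x. ennreal (min (\<bar>x t\<bar>\<^sup>2) 1) \<partial>\<nu>) < \<infinity>) \<and>
    (\<forall>A \<in> sets cylindrical. emeasure \<nu> A = inner_measure \<nu> (A - {\<lambda>_. 0}))"

definition nonneg_definite :: "('t \<Rightarrow> 't \<Rightarrow> real) \<Rightarrow> bool" where
  "nonneg_definite \<Sigma> \<longleftrightarrow>
    (\<forall>s t. \<Sigma> s t = \<Sigma> t s) \<and>
    (\<forall>I a. finite I \<longrightarrow> (\<Sum>s\<in>I. \<Sum>t\<in>I. a s * a t * \<Sigma> s t) \<ge> 0)"

text \<open>
  The integrand in the exponent is bounded by a constant multiple of the sum over \<open>I\<close> of
  \<open>min (\<bar>x t\<bar>\<^sup>2) 1\<close>, so it is integrable for every Levy measure.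
\<close>

definition levy_measure_of ::
    "'w measure \<Rightarrow> ('t \<Rightarrow> 'w \<Rightarrow> real) \<Rightarrow> ('t \<Rightarrow> real) measure \<Rightarrow> bool" where
  "levy_measure_of M X \<nu> \<longleftrightarrow>
    levy_measure \<nu> \<and>
    (\<exists>\<Sigma> b. nonneg_definite \<Sigma> \<and>
      (\<forall>I a. finite I \<and> I \<noteq> {} \<longrightarrow>
        (LINT \<omega>|M. iexp (\<Sum>t\<in>I. a t * X t \<omega>)) =
          exp (- complex_of_real ((\<Sum>s\<in>I. \<Sum>t\<in>I. a s * a t * \<Sigma> s t) / 2)
             + (LINT x|\<nu>. iexp (\<Sum>t\<in>I. a t * x t) - 1
                  - \<i> * complex_of_real (\<Sum>t\<in>I. a t * x t * indicator {y. \<bar>y\<bar> \<le> 1} (x t)))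
             + \<i> * complex_of_real (\<Sum>t\<in>I. a t * b t))))"

text \<open>
  The expectation of a real random variable exists, possibly as an infinite value, if its
  positive part or its negative part has finite expectation.
\<close>

definition expectation_exists :: "'w measure \<Rightarrow> ('w \<Rightarrow> real) \<Rightarrow> bool" where
  "expectation_exists M Y \<longleftrightarrow>
    Y \<in> borel_measurable M \<and>
    ((\<integral>\<^sup>+ \<omega>. ennreal (Y \<omega>) \<partial>M) < \<infinity> \<or> (\<integral>\<^sup>+ \<omega>. ennreal (- Y \<omega>) \<partial>M) < \<infinity>)"

definition ext_expectation :: "'w measure \<Rightarrow> ('w \<Rightarrow> real) \<Rightarrow> ereal" where
  "ext_expectation M Y =
    enn2ereal (\<integral>\<^sup>+ \<omega>. ennreal (Y \<omega>) \<partial>M) - enn2ereal (\<integral>\<^sup>+ \<omega>. ennreal (- Y \<omega>) \<partial>M)"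

definition expectation_identity :: "'w measure \<Rightarrow> ('w \<Rightarrow> real) \<Rightarrow> ('w \<Rightarrow> real) \<Rightarrow> bool" where
  "expectation_identity M Y W \<longleftrightarrow>
    (expectation_exists M Y \<longleftrightarrow> expectation_exists M W) \<and>
    (expectation_exists M Y \<longrightarrow> ext_expectation M Y = ext_expectation M W)"

lemma integrable_iff_finite_ext_expectation:
  "integrable M Y \<longleftrightarrow> expectation_exists M Y \<and> \<bar>ext_expectation M Y\<bar> \<noteq> \<infinity>"
  unfolding real_integrable_def expectation_exists_def ext_expectation_def
  by (cases "\<integral>\<^sup>+ \<omega>. ennreal (Y \<omega>) \<partial>M"; cases "\<integral>\<^sup>+ \<omega>. ennreal (- Y \<omega>) \<partial>M")
     (auto simp: enn2ereal_ennreal)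

lemma ext_expectation_integrable:
  assumes "integrable M Y"
  shows "ext_expectation M Y = ereal (LINT \<omega>|M. Y \<omega>)"
  using assms unfolding real_integrable_def ext_expectation_def real_lebesgue_integral_def[OF assms]
  by (cases "\<integral>\<^sup>+ \<omega>. ennreal (Y \<omega>) \<partial>M"; cases "\<integral>\<^sup>+ \<omega>. ennreal (- Y \<omega>) \<partial>M")
     (auto simp: enn2ereal_ennreal)

lemma expectation_identity_integrable:
  assumes "expectation_identity M Y W"
  shows "integrable M Y \<longleftrightarrow> integrable M W"
    and "(LINT \<omega>|M. Y \<omega>) = (LINT \<omega>|M. W \<omega>)"
proof -
  show iff: "integrable M Y \<longleftrightarrow> integrable M W"
    using assms unfolding integrable_iff_finite_ext_expectation expectation_identity_def by auto
  show "(LINT \<omega>|M. Y \<omega>) = (LINT \<omega>|M. W \<omega>)"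
  proof (cases "integrable M Y")
    case True
    then have "expectation_exists M Y" "integrable M W"
      using integrable_iff_finite_ext_expectation iff by auto
    then show ?thesis
      using assms ext_expectation_integrable[OF True] ext_expectation_integrable[of M W]
      unfolding expectation_identity_def by auto
  qed (use iff in \<open>simp add: not_integrable_integral_eq\<close>)
qed

end

theory Submission
  imports Defs "HOL-Real_Asymp.Real_Asymp"
begin

text \<open>
  Write \<open>\<mu>\<close> for the law of \<open>X\<close>.  The measure \<open>\<nu>\<close> is \<open>\<sigma>\<close>-finite, so the law of \<open>Z\<close> is absolutely
  continuous with respect to a finite measure \<open>\<eta> = h \<cdot> \<nu>\<close> with \<open>0 \<le> h \<le> 1\<close>: truncate the density at
  one (\<open>finite_measure_bounded_density\<close>).  Convolution with \<open>\<mu>\<close> preserves absolute continuity, so it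
  is enough that \<open>\<mu> * \<eta>\<close> is absolutely continuous with respect to \<open>\<mu>\<close>.

  Heuristically, \<open>\<mu>\<close> is \<open>Q * P\<close>, where \<open>P = e\<^sup>-\<^sup>c \<Sum>\<^sub>k \<eta>\<^sup>*\<^sup>k / k!\<close> is the compound Poisson law with
  Levy measure \<open>\<eta>\<close>, of mass \<open>c\<close>, and \<open>Q\<close> is the infinitely divisible law with the remaining
  Levy measure \<open>(1 - h) \<cdot> \<nu>\<close>.  Since \<open>P * \<eta> = e\<^sup>-\<^sup>c \<Sum>\<^sub>k k \<eta>\<^sup>*\<^sup>k / k!\<close>, convolving \<open>\<mu>\<close> with \<open>\<eta>\<close> only
  multiplies the \<open>k\<close>th term by \<open>k\<close>.  Cutting at \<open>k = K\<close> gives the quantitative inequality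
  \<open>(\<mu> * \<eta>)(B) \<le> K \<mu>(B) + \<tau>\<^sub>K\<close>, where \<open>\<tau>\<^sub>K\<close> is the tail of a convergent series; a
  \<open>\<mu>\<close>-null set is therefore \<open>\<mu> * \<eta>\<close>-null.

  Constructing \<open>Q\<close> would need the existence half of the Levy-Khintchine theorem and a projective
  limit.  An inequality between integrals, unlike absolute continuity, survives limits, and it is
  enough to have it for a class of functions that determines both sides.  So test functions are the
  trigonometric polynomials in finitely many coordinates with values in \<open>[0, 1]\<close>.  On them a
  characteristic function acts by multiplying coefficients, and the role of a positive measure is
  taken by a multiplier that preserves nonnegativity.  Such multipliers form a cone closed under
  products, exponentials and pointwise limits (\<open>positive_multiplier_powser\<close>,
  \<open>positive_multiplier_lim\<close>).  The characteristic function of the law \<open>Q\<close> is in this cone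
  because it is a limit of products of explicit factors: a Gaussian one
  (\<open>positive_multiplier_gaussian\<close>), shifts, and compound Poisson ones
  (\<open>positive_multiplier_levy_quotient\<close>).  Then \<open>poisson_multiplier_le\<close> is the inequality above for
  test functions, and \<open>unit_trig_polys_L1_dense\<close> extends it to all cylindrical sets.

  The functional \<open>g\<close> is the Radon-Nikodym density of the law of \<open>X + Z\<close> with respect to \<open>\<mu>\<close>.
\<close>

section \<open>Approximation in mean by a multiplicative class of functions\<close>

text \<open>
  The conditions on \<open>S\<close> are what makes the class of sets whose indicators are limits in mean of
  members of \<open>S\<close> a \<open>\<sigma>\<close>-algebra: the complement is \<open>1 - f\<close> and the intersection is a product.
  Approximation is simultaneous for all measures in \<open>\<M>\<close>, because an inequality between integrals
  with respect to two different measures has to be transported along one approximating function.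
\<close>
locale L1_dense_class =
  fixes N :: "'a measure" and \<M> :: "'a measure set" and S :: "('a \<Rightarrow> real) set"
  assumes finite_\<M>: "finite \<M>"
    and measures: "\<And>m. m \<in> \<M> \<Longrightarrow> finite_measure m" "\<And>m. m \<in> \<M> \<Longrightarrow> sets m = sets N"
    and S_measurable: "\<And>f. f \<in> S \<Longrightarrow> f \<in> borel_measurable N"
    and S_range: "\<And>f x. f \<in> S \<Longrightarrow> 0 \<le> f x \<and> f x \<le> 1"
    and S_one: "(\<lambda>_. 1) \<in> S"
    and S_compl: "\<And>f. f \<in> S \<Longrightarrow> (\<lambda>x. 1 - f x) \<in> S"
    and S_mult: "\<And>f g. f \<in> S \<Longrightarrow> g \<in> S \<Longrightarrow> (\<lambda>x. f x * g x) \<in> S"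
begin

definition approximable :: "('a \<Rightarrow> real) \<Rightarrow> bool" where
  "approximable g \<longleftrightarrow> g \<in> borel_measurable N \<and> (\<forall>x. 0 \<le> g x \<and> g x \<le> 1) \<and>
     (\<forall>e>0. \<exists>f\<in>S. \<forall>m\<in>\<M>. (\<integral>x. \<bar>f x - g x\<bar> \<partial>m) < e)"

lemma approximable_measurable: "approximable g \<Longrightarrow> g \<in> borel_measurable N"
  and approximable_nonneg: "approximable g \<Longrightarrow> 0 \<le> g x"
  and approximable_le_one: "approximable g \<Longrightarrow> g x \<le> 1"
  and approximableD: "approximable g \<Longrightarrow> 0 < e \<Longrightarrow> \<exists>f\<in>S. \<forall>m\<in>\<M>. (\<integral>x. \<bar>f x - g x\<bar> \<partial>m) < e"
  unfolding approximable_def by simp_all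

lemma integrable_unit_range:
  fixes f :: "'a \<Rightarrow> real"
  assumes "m \<in> \<M>" "f \<in> borel_measurable N" "\<And>x. \<bar>f x\<bar> \<le> 1"
  shows "integrable m f"
proof -
  interpret finite_measure m by (rule measures) fact
  have "f \<in> borel_measurable m"
    using assms(2) measurable_cong_sets[OF measures(2)[OF assms(1)] refl] by blast
  then show ?thesis by (rule integrable_const_bound[where B = 1, rotated]) (use assms(3) in auto)
qed

lemma abs_diff_unit: "0 \<le> (a::real) \<and> a \<le> 1 \<Longrightarrow> 0 \<le> b \<and> b \<le> 1 \<Longrightarrow> \<bar>a - b\<bar> \<le> 1"
  by auto

lemma integrable_dist:
  assumes "m \<in> \<M>" "f \<in> borel_measurable N" "g \<in> borel_measurable N"
    "\<And>x. 0 \<le> f x \<and> f x \<le> 1" "\<And>x. 0 \<le> g x \<and> g x \<le> (1::real)"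
  shows "integrable m (\<lambda>x. \<bar>f x - g x\<bar>)"
proof (rule integrable_unit_range[OF assms(1)])
  show "(\<lambda>x. \<bar>f x - g x\<bar>) \<in> borel_measurable N" using assms(2,3) by measurable
  show "\<bar>\<bar>f x - g x\<bar>\<bar> \<le> 1" for x using abs_diff_unit[OF assms(4) assms(5)] by simp
qed

lemma approximable_member: "f \<in> S \<Longrightarrow> approximable f"
  unfolding approximable_def using S_measurable S_range by (auto intro!: bexI[of _ f])

lemma approximable_compl: "approximable g \<Longrightarrow> approximable (\<lambda>x. 1 - g x)"
  unfolding approximable_def
proof (intro conjI allI impI)
  fix e :: real assume g: "g \<in> borel_measurable N \<and> (\<forall>x. 0 \<le> g x \<and> g x \<le> 1) \<and>
     (\<forall>e>0. \<exists>f\<in>S. \<forall>m\<in>\<M>. (\<integral>x. \<bar>f x - g x\<bar> \<partial>m) < e)" and "e > 0"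
  then obtain f where f: "f \<in> S" "\<forall>m\<in>\<M>. (\<integral>x. \<bar>f x - g x\<bar> \<partial>m) < e" by blast
  have eq: "\<bar>(1 - f x) - (1 - g x)\<bar> = \<bar>f x - g x\<bar>" for x by simp
  show "\<exists>f\<in>S. \<forall>m\<in>\<M>. (\<integral>x. \<bar>f x - (1 - g x)\<bar> \<partial>m) < e"
    by (rule bexI[OF _ S_compl[OF f(1)]]) (simp only: eq, rule f(2))
qed auto

text \<open>
  Values in \<open>[0, 1]\<close> make \<open>\<bar>u v - g h\<bar> \<le> \<bar>u - g\<bar> + \<bar>v - h\<bar>\<close>.
\<close>
lemma approximable_mult:
  assumes g: "approximable g" and h: "approximable h"
  shows "approximable (\<lambda>x. g x * h x)"
  unfolding approximable_def
proof (intro conjI allI impI)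
  note gh = approximable_measurable[OF g] approximable_measurable[OF h]
    approximable_nonneg[OF g] approximable_nonneg[OF h]
    approximable_le_one[OF g] approximable_le_one[OF h]
  show gh_meas: "(\<lambda>x. g x * h x) \<in> borel_measurable N" using gh(1,2) by measurable
  show "0 \<le> g x * h x" "g x * h x \<le> 1" for x using gh by (simp_all add: mult_le_one)
  fix e :: real assume "e > 0"
  then have "e / 2 > 0" by simp
  then obtain u v where u: "u \<in> S" "\<forall>m\<in>\<M>. (\<integral>x. \<bar>u x - g x\<bar> \<partial>m) < e / 2"
    and v: "v \<in> S" "\<forall>m\<in>\<M>. (\<integral>x. \<bar>v x - h x\<bar> \<partial>m) < e / 2"
    using approximableD[OF g] approximableD[OF h] by meson
  have "(\<integral>x. \<bar>u x * v x - g x * h x\<bar> \<partial>m) < e" if m: "m \<in> \<M>" for m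
  proof -
    have i: "integrable m (\<lambda>x. \<bar>u x - g x\<bar>)" "integrable m (\<lambda>x. \<bar>v x - h x\<bar>)"
      "integrable m (\<lambda>x. \<bar>u x * v x - g x * h x\<bar>)"
      using gh gh_meas S_measurable[OF u(1)] S_measurable[OF v(1)] S_range[OF u(1)] S_range[OF v(1)]
      by (intro integrable_dist[OF m]; simp add: mult_le_one)+
    have "(\<integral>x. \<bar>u x * v x - g x * h x\<bar> \<partial>m) \<le> (\<integral>x. \<bar>u x - g x\<bar> + \<bar>v x - h x\<bar> \<partial>m)"
    proof (intro integral_mono i Bochner_Integration.integrable_add)
      fix x
      have "u x * v x - g x * h x = (u x - g x) * v x + g x * (v x - h x)"
        by (simp add: algebra_simps)
      also have "\<bar>\<dots>\<bar> \<le> \<bar>u x - g x\<bar> * \<bar>v x\<bar> + \<bar>g x\<bar> * \<bar>v x - h x\<bar>"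
        by (metis abs_mult abs_triangle_ineq)
      also have "\<dots> \<le> \<bar>u x - g x\<bar> * 1 + 1 * \<bar>v x - h x\<bar>"
        using S_range[OF v(1), of x] gh by (intro add_mono mult_mono) auto
      finally show "\<bar>u x * v x - g x * h x\<bar> \<le> \<bar>u x - g x\<bar> + \<bar>v x - h x\<bar>" by simp
    qed
    also have "\<dots> < e"
      using u(2)[rule_format, OF m] v(2)[rule_format, OF m] by (simp add: i)
    finally show ?thesis .
  qed
  then show "\<exists>f\<in>S. \<forall>m\<in>\<M>. (\<integral>x. \<bar>f x - g x * h x\<bar> \<partial>m) < e"
    using S_mult[OF u(1) v(1)] by (intro bexI[of _ "\<lambda>x. u x * v x"]) auto
qed

lemma approximable_lim:
  assumes gn: "\<And>n::nat. approximable (g n)" and lim: "\<And>x. (\<lambda>n. g n x) \<longlonglongrightarrow> h x"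
  shows "approximable h"
  unfolding approximable_def
proof (intro conjI allI impI)
  note gn' = approximable_measurable[OF gn] approximable_nonneg[OF gn] approximable_le_one[OF gn]
  show hm: "h \<in> borel_measurable N"
    by (rule borel_measurable_LIMSEQ_real[OF lim gn'(1)])
  show h0: "0 \<le> h x" for x by (rule LIMSEQ_le_const[OF lim]) (use gn' in simp)
  show h1: "h x \<le> 1" for x by (rule LIMSEQ_le_const2[OF lim]) (use gn' in simp)
  fix e :: real assume e: "e > 0"
  have "\<forall>m\<in>\<M>. eventually (\<lambda>n. (\<integral>x. \<bar>g n x - h x\<bar> \<partial>m) < e / 2) sequentially"
  proof
    fix m assume m: "m \<in> \<M>"
    interpret finite_measure m by (rule measures) fact
    have meas: "u \<in> borel_measurable N \<Longrightarrow> u \<in> borel_measurable m" for u :: "'a \<Rightarrow> real"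
      using measurable_cong_sets[OF measures(2)[OF m] refl] by blast
    have "(\<lambda>n. \<integral>x. \<bar>g n x - h x\<bar> \<partial>m) \<longlonglongrightarrow> (\<integral>x. 0 \<partial>m)"
    proof (rule integral_dominated_convergence[where w = "\<lambda>_. 1"])
      show "(\<lambda>x. \<bar>g i x - h x\<bar>) \<in> borel_measurable m" for i
        using gn'(1) hm by (intro meas borel_measurable_abs borel_measurable_diff) auto
      show "AE x in m. (\<lambda>n. \<bar>g n x - h x\<bar>) \<longlonglongrightarrow> 0"
        using tendsto_rabs_zero[OF LIM_zero[OF lim]] by auto
      show "AE x in m. norm \<bar>g i x - h x\<bar> \<le> 1" for i
        using abs_diff_unit[of "g i x" "h x" for x] gn' h0 h1 by simp
    qed auto
    then have "(\<lambda>n. \<integral>x. \<bar>g n x - h x\<bar> \<partial>m) \<longlonglongrightarrow> 0" by simp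
    from order_tendstoD(2)[OF this, of "e / 2"]
    show "eventually (\<lambda>n. (\<integral>x. \<bar>g n x - h x\<bar> \<partial>m) < e / 2) sequentially" using e by simp
  qed
  then have "eventually (\<lambda>n. \<forall>m\<in>\<M>. (\<integral>x. \<bar>g n x - h x\<bar> \<partial>m) < e / 2) sequentially"
    by (rule eventually_ball_finite[OF finite_\<M>])
  then obtain n where n: "\<forall>m\<in>\<M>. (\<integral>x. \<bar>g n x - h x\<bar> \<partial>m) < e / 2"
    by (auto simp: eventually_sequentially)
  obtain f where f: "f \<in> S" "\<forall>m\<in>\<M>. (\<integral>x. \<bar>f x - g n x\<bar> \<partial>m) < e / 2"
    using approximableD[OF gn[of n], of "e / 2"] e by auto
  have "(\<integral>x. \<bar>f x - h x\<bar> \<partial>m) < e" if m: "m \<in> \<M>" for m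
  proof -
    have i: "integrable m (\<lambda>x. \<bar>f x - g n x\<bar>)" "integrable m (\<lambda>x. \<bar>g n x - h x\<bar>)"
      "integrable m (\<lambda>x. \<bar>f x - h x\<bar>)"
      using gn' S_measurable[OF f(1)] S_range[OF f(1)] hm h0 h1
      by (intro integrable_dist[OF m]; simp)+
    have "(\<integral>x. \<bar>f x - h x\<bar> \<partial>m) \<le> (\<integral>x. \<bar>f x - g n x\<bar> + \<bar>g n x - h x\<bar> \<partial>m)"
      by (intro integral_mono i Bochner_Integration.integrable_add) auto
    also have "\<dots> < e"
      using f(2)[rule_format, OF m] n[rule_format, OF m] by (simp add: i)
    finally show ?thesis .
  qed
  then show "\<exists>f\<in>S. \<forall>m\<in>\<M>. (\<integral>x. \<bar>f x - h x\<bar> \<partial>m) < e"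
    using f(1) by blast
qed

lemma approximable_power: "approximable g \<Longrightarrow> approximable (\<lambda>x. g x ^ n)"
  by (induction n) (simp_all add: approximable_member[OF S_one] approximable_mult)

lemma sigma_algebra_approximable:
  assumes space: "space N = UNIV"
  shows "sigma_algebra UNIV {B \<in> sets N. approximable (indicator B)}"
proof -
  let ?A = "{B \<in> sets N. approximable (indicator B)}"
  have compl: "UNIV - B \<in> ?A" if "B \<in> ?A" for B
  proof -
    have "(\<lambda>x. 1 - indicator B x) = (indicator (UNIV - B) :: 'a \<Rightarrow> real)"
      by (auto simp: indicator_def fun_eq_iff)
    then show ?thesis
      using that approximable_compl[of "indicator B"] sets.compl_sets[of B N] space by auto
  qed
  have "approximable (\<lambda>_. 1 - 1)" by (intro approximable_compl approximable_member S_one)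
  then have empty: "{} \<in> ?A" by (simp add: indicator_def[abs_def])
  have int: "B \<inter> C \<in> ?A" if "B \<in> ?A" "C \<in> ?A" for B C
    using that approximable_mult[of "indicator B" "indicator C"]
    by (auto simp: indicator_inter_arith[abs_def])
  interpret algebra UNIV ?A
    unfolding algebra_iff_Int using compl empty int by auto
  show ?thesis
  proof (unfold_locales)
    fix A :: "nat \<Rightarrow> 'a set" assume A: "range A \<subseteq> ?A"
    have fin: "(\<Union>i<n. A i) \<in> ?A" for n using A by (intro finite_UN) auto
    have "(\<lambda>n. indicator (\<Union>i<n. A i) x) \<longlonglongrightarrow> (indicator (\<Union>i. A i) x :: real)" for x
      by (rule LIMSEQ_indicator_UN)
    then have "approximable (indicator (\<Union>i. A i))"
      by (rule approximable_lim[rotated]) (use fin in simp)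
    then show "(\<Union>i. A i) \<in> ?A" using A by auto
  qed
qed

text \<open>
  The polynomials \<open>(1 - z\<^sup>n)\<^sup>N\<close> with \<open>N = n 2\<^sup>n\<close> map \<open>[0, 1]\<close> to itself and tend to one where
  \<open>z < 1 / 2\<close> (Bernoulli) and to zero elsewhere.  The factor \<open>n\<close> in the exponent is there for
  \<open>z = 1 / 2\<close>, where \<open>2\<^sup>n\<close> alone would give the limit \<open>1 / e\<close>.
\<close>
lemma approximable_sublevel:
  assumes z: "approximable z"
  shows "approximable (indicator {x. z x < 1 / 2})"
proof (rule approximable_lim)
  show "approximable (\<lambda>x. (1 - z x ^ n) ^ (n * 2 ^ n))" for n
    by (intro approximable_power approximable_compl z)
next
  fix x
  define y where "y = z x"
  have y: "0 \<le> y" "y \<le> 1" using approximable_nonneg[OF z] approximable_le_one[OF z] by (simp_all add: y_def)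
  show "(\<lambda>n. (1 - z x ^ n) ^ (n * 2 ^ n)) \<longlonglongrightarrow> indicator {x. z x < 1 / 2} x"
  proof (cases "y < 1 / 2")
    case True
    have lower: "(\<lambda>n. 1 - real n * (2 * y) ^ n) \<longlonglongrightarrow> 1"
      using tendsto_diff[OF tendsto_const powser_times_n_limit_0[of "2 * y"], of 1] True y by simp
    have bernoulli: "1 - real n * (2 * y) ^ n \<le> (1 - y ^ n) ^ (n * 2 ^ n)" for n
      using Bernoulli_inequality[of "- (y ^ n)" "n * 2 ^ n"] y
      by (simp add: power_mult_distrib power_le_one mult_ac)
    have le_one: "(1 - y ^ n) ^ (n * 2 ^ n) \<le> 1" for n
      using y by (simp add: power_le_one)
    have "(\<lambda>n. (1 - y ^ n) ^ (n * 2 ^ n)) \<longlonglongrightarrow> 1"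
      by (rule real_tendsto_sandwich[OF _ _ lower tendsto_const]) (rule always_eventually, rule allI, (rule bernoulli le_one))+
    then show ?thesis using True by (simp add: y_def)
  next
    case False
    have upper: "(1 - y ^ n) ^ (n * 2 ^ n) \<le> exp (- real n)" for n
    proof -
      have "(1 - y ^ n) ^ (n * 2 ^ n) \<le> exp (- (y ^ n)) ^ (n * 2 ^ n)"
        using exp_ge_add_one_self[of "- (y ^ n)"] y by (intro power_mono) (simp_all add: power_le_one)
      also have "\<dots> = exp (- (real n * (2 * y) ^ n))"
        by (simp add: exp_of_nat_mult[symmetric] power_mult_distrib mult_ac)
      also have "\<dots> \<le> exp (- real n)"
      proof -
        have "1 \<le> (2 * y) ^ n" using False by (intro one_le_power) auto
        then have "real n * 1 \<le> real n * (2 * y) ^ n" by (intro mult_left_mono) auto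
        then show ?thesis by simp
      qed
      finally show ?thesis .
    qed
    have exp_0: "(\<lambda>n. exp (- real n)) \<longlonglongrightarrow> 0"
      by real_asymp
    have nonneg: "0 \<le> (1 - y ^ n) ^ (n * 2 ^ n)" for n
      using y by (simp add: power_le_one)
    have "(\<lambda>n. (1 - y ^ n) ^ (n * 2 ^ n)) \<longlonglongrightarrow> 0"
      by (rule real_tendsto_sandwich[OF _ _ tendsto_const exp_0]) (rule always_eventually, rule allI, (rule upper nonneg))+
    then show ?thesis using False by (simp add: y_def)
  qed
qed

end

section \<open>Trigonometric polynomials on path space\<close>

definition character :: "'t set \<Rightarrow> ('t \<Rightarrow> real) \<Rightarrow> ('t \<Rightarrow> real) \<Rightarrow> complex" where
  "character I a x = iexp (\<Sum>t\<in>I. a t * x t)"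

lemma iexp_add: "iexp (a + b) = iexp a * iexp b"
  by (simp add: distrib_left exp_add)

lemma character_zero [simp]: "character I (\<lambda>_. 0) x = 1" "character I a (\<lambda>_. 0) = 1"
  by (simp_all add: character_def)

lemma norm_character [simp]: "norm (character I a x) = 1"
  unfolding character_def by simp

lemma character_translate: "character I a (\<lambda>t. x t + y t) = character I a x * character I a y"
  unfolding character_def distrib_left sum.distrib iexp_add ..

lemma character_add_freq: "character I (\<lambda>t. a t + b t) x = character I a x * character I b x"
  unfolding character_def distrib_right sum.distrib iexp_add ..

lemma character_uminus_freq: "character I (\<lambda>t. - a t) x = cnj (character I a x)"
  unfolding character_def by (simp add: exp_cnj sum_negf)

lemma character_extend:
  assumes "finite J" "I \<subseteq> J"
  shows "character J (\<lambda>t. if t \<in> I then a t else 0) x = character I a x"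
proof -
  have "(\<Sum>t\<in>J. (if t \<in> I then a t else 0) * x t) = (\<Sum>t\<in>I. a t * x t)"
    using assms by (intro sum.mono_neutral_cong_right) auto
  then show ?thesis unfolding character_def by (rule arg_cong)
qed

lemma character_measurable [measurable]: "character I a \<in> borel_measurable cylindrical"
proof -
  have "(\<lambda>x. \<Sum>t\<in>I. a t * x t) \<in> borel_measurable cylindrical" by measurable
  moreover have "iexp \<in> borel_measurable borel"
    by (intro borel_measurable_continuous_onI continuous_intros)
  ultimately show ?thesis unfolding character_def[abs_def] by (rule measurable_compose)
qed

definition trig_poly :: "'t set \<Rightarrow> (complex \<times> ('t \<Rightarrow> real)) list \<Rightarrow> ('t \<Rightarrow> real) \<Rightarrow> real" where
  "trig_poly I p x = Re (\<Sum>(c, a)\<leftarrow>p. c * character I a x)"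

lemma trig_poly_Nil [simp]: "trig_poly I [] x = 0"
  and trig_poly_Cons [simp]:
    "trig_poly I (ca # p) x = Re (fst ca * character I (snd ca) x) + trig_poly I p x"
  and trig_poly_append [simp]: "trig_poly I (p @ q) x = trig_poly I p x + trig_poly I q x"
  by (simp_all add: trig_poly_def case_prod_beta)

lemma trig_poly_measurable [measurable]: "trig_poly I p \<in> borel_measurable cylindrical"
proof (induction p)
  case Nil then show ?case by (simp add: trig_poly_def[abs_def])
next
  case (Cons ca p)
  have "(\<lambda>x. Re (fst ca * character I (snd ca) x) + trig_poly I p x) \<in> borel_measurable cylindrical"
    using Cons by measurable
  then show ?case by (subst measurable_cong[OF trig_poly_Cons])
qed

lemma trig_poly_extend:
  assumes "finite J" "I \<subseteq> J"
  shows "trig_poly J (map (\<lambda>(c, a). (c, \<lambda>t. if t \<in> I then a t else 0)) p) x = trig_poly I p x"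
  by (induction p) (auto simp: character_extend[OF assms])

text \<open>
  Products stay trigonometric because \<open>Re u \<cdot> Re v = Re (u v + u cnj v) / 2\<close>.
\<close>
lemma trig_poly_monomial_mult:
  "Re (c * character I a x) * trig_poly I q x =
   trig_poly I (map (\<lambda>(d, b). (c * d / 2, \<lambda>t. a t + b t)) q @
     map (\<lambda>(d, b). (c * cnj d / 2, \<lambda>t. a t + - b t)) q) x"
proof (induction q)
  case (Cons db q)
  obtain d b where db: "db = (d, b)" by force
  define u v where "u = c * character I a x" and "v = d * character I b x"
  have 1: "c * d / 2 * character I (\<lambda>t. a t + b t) x = u * v / 2"
    unfolding character_add_freq u_def v_def by simp
  have 2: "c * cnj d / 2 * character I (\<lambda>t. a t + - b t) x = u * cnj v / 2"
    unfolding character_add_freq character_uminus_freq u_def v_def complex_cnj_mult by simp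
  have 3: "Re u * Re v = Re (u * v / 2) + Re (u * cnj v / 2)" by (simp add: field_simps)
  show ?case using Cons.IH unfolding db u_def[symmetric]
    by (simp only: trig_poly_append trig_poly_Cons list.map prod.case fst_conv snd_conv 1 2
        v_def[symmetric] distrib_left 3 append_Cons)
qed simp

lemma trig_poly_mult: "\<exists>r. \<forall>x. trig_poly I r x = trig_poly I p x * trig_poly I q x"
proof (induction p)
  case Nil show ?case by (rule exI[of _ "[]"]) simp
next
  case (Cons ca p)
  then obtain r where r: "\<forall>x. trig_poly I r x = trig_poly I p x * trig_poly I q x" by blast
  obtain c a where ca: "ca = (c, a)" by force
  show ?case
    unfolding ca trig_poly_Cons distrib_right fst_conv snd_conv trig_poly_monomial_mult
      r[rule_format, symmetric] trig_poly_append[symmetric] by blast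
qed

text \<open>
  A common nonempty finite index set of coordinates is part of the definition because the
  characteristic function of the process is prescribed only for such sets.
\<close>
definition unit_trig_polys :: "(('t \<Rightarrow> real) \<Rightarrow> real) set" where
  "unit_trig_polys = {f. \<exists>I p. finite I \<and> I \<noteq> {} \<and> f = trig_poly I p \<and> (\<forall>x. 0 \<le> f x \<and> f x \<le> 1)}"

lemma unit_trig_polysI:
  assumes "finite I" "I \<noteq> {}" "\<And>x. trig_poly I p x = f x" "\<And>x. 0 \<le> f x \<and> f x \<le> 1"
  shows "f \<in> unit_trig_polys"
  using assms unfolding unit_trig_polys_def by (auto intro!: exI[of _ I] exI[of _ p])

lemma unit_trig_polysE:
  assumes "f \<in> unit_trig_polys"
  obtains I p where "finite I" "I \<noteq> {}" "f = trig_poly I p" "\<And>x. 0 \<le> f x \<and> f x \<le> 1"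
  using assms unfolding unit_trig_polys_def mem_Collect_eq by metis

lemma unit_trig_polys_dense_class:
  fixes \<M> :: "('t \<Rightarrow> real) measure set"
  assumes "finite \<M>" "\<And>m. m \<in> \<M> \<Longrightarrow> finite_measure m" "\<And>m. m \<in> \<M> \<Longrightarrow> sets m = sets cylindrical"
  shows "L1_dense_class cylindrical \<M> unit_trig_polys"
proof (rule L1_dense_class.intro)
  show "f \<in> borel_measurable cylindrical" if "f \<in> unit_trig_polys" for f :: "('t \<Rightarrow> real) \<Rightarrow> real"
    using that unfolding unit_trig_polys_def by auto
  show "0 \<le> f x \<and> f x \<le> 1" if "f \<in> unit_trig_polys" for f :: "('t \<Rightarrow> real) \<Rightarrow> real" and x
    using that unfolding unit_trig_polys_def by auto
  show "(\<lambda>_. 1) \<in> unit_trig_polys"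
    by (rule unit_trig_polysI[of "{undefined}" "[(1, \<lambda>_. 0)]"]) auto
  show "(\<lambda>x. 1 - f x) \<in> unit_trig_polys" if fS: "f \<in> unit_trig_polys" for f :: "('t \<Rightarrow> real) \<Rightarrow> real"
  proof -
    obtain I p where f: "finite I" "I \<noteq> {}" "f = trig_poly I p" "\<And>x. 0 \<le> f x \<and> f x \<le> 1"
      using unit_trig_polysE[OF fS] by metis
    have "trig_poly I (map (\<lambda>(c, a). (- c, a)) p) x = - trig_poly I p x" for x
      by (induction p) auto
    then show ?thesis using f
      by (intro unit_trig_polysI[of I "(1, \<lambda>_. 0) # map (\<lambda>(c, a). (- c, a)) p"]) auto
  qed
  show "(\<lambda>x. f x * g x) \<in> unit_trig_polys"
    if fg: "f \<in> unit_trig_polys" "g \<in> unit_trig_polys" for f g :: "('t \<Rightarrow> real) \<Rightarrow> real"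
  proof -
    obtain I p where f: "finite I" "I \<noteq> {}" "f = trig_poly I p" "\<And>x. 0 \<le> f x \<and> f x \<le> 1"
      using unit_trig_polysE[OF fg(1)] by metis
    obtain J q where g: "finite J" "J \<noteq> {}" "g = trig_poly J q" "\<And>x. 0 \<le> g x \<and> g x \<le> 1"
      using unit_trig_polysE[OF fg(2)] by metis
    define p' q' where "p' = map (\<lambda>(c, a). (c, \<lambda>t. if t \<in> I then a t else 0)) p"
      and "q' = map (\<lambda>(c, a). (c, \<lambda>t. if t \<in> J then a t else 0)) q"
    have p': "trig_poly (I \<union> J) p' x = f x" and q': "trig_poly (I \<union> J) q' x = g x" for x
      unfolding p'_def q'_def f(3) g(3) using f(1) g(1) by (simp_all add: trig_poly_extend)
    obtain r where r: "\<forall>x. trig_poly (I \<union> J) r x = trig_poly (I \<union> J) p' x * trig_poly (I \<union> J) q' x"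
      using trig_poly_mult by blast
    show ?thesis
    proof (rule unit_trig_polysI)
      show "trig_poly (I \<union> J) r x = f x * g x" for x by (simp only: r p' q')
      show "0 \<le> f x * g x \<and> f x * g x \<le> 1" for x
        using f(4)[of x] g(4)[of x] by (simp add: mult_le_one)
    qed (use f(1,2) g(1) in simp_all)
  qed
qed (fact assms)+

text \<open>
  A half-line \<open>{x. x t < c}\<close> is the limit of \<open>{x. sin ((x t - c) / n) < 0}\<close> as the period grows, and
  the latter is a sublevel set of a trigonometric polynomial with values in \<open>[0, 1]\<close>.  The half-lines
  generate the cylindrical \<open>\<sigma>\<close>-algebra.
\<close>
lemma unit_trig_polys_L1_dense:
  fixes \<M> :: "('t \<Rightarrow> real) measure set"
  assumes \<M>: "finite \<M>" "\<And>m. m \<in> \<M> \<Longrightarrow> finite_measure m" "\<And>m. m \<in> \<M> \<Longrightarrow> sets m = sets cylindrical"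
    and B: "B \<in> sets cylindrical" and e: "e > 0"
  shows "\<exists>f\<in>unit_trig_polys. \<forall>m\<in>\<M>. (\<integral>x. \<bar>f x - indicator B x\<bar> \<partial>m) < e"
proof -
  interpret L1_dense_class cylindrical \<M> unit_trig_polys
    by (rule unit_trig_polys_dense_class[OF \<M>])
  let ?A = "{B \<in> sets cylindrical. approximable (indicator B)} :: ('t \<Rightarrow> real) set set"
  interpret A: sigma_algebra UNIV ?A
    by (rule sigma_algebra_approximable) (simp add: space_PiM)
  have half_line: "{x. x t < c} \<in> ?A" for t :: 't and c :: real
  proof -
    define z where "z n x = (1 + sin ((x t - c) / real (Suc n))) / 2" for n and x :: "'t \<Rightarrow> real"
    have "z n \<in> unit_trig_polys" for n
    proof (rule unit_trig_polysI[of "{t}" "[(1 / 2, \<lambda>_. 0),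
        (- \<i> * iexp (- c / real (Suc n)) / 2, \<lambda>_. 1 / real (Suc n))]"])
      fix x :: "'t \<Rightarrow> real"
      define k where "k = iexp (- c / real (Suc n))"
      define e where "e = character {t} (\<lambda>_. 1 / real (Suc n)) x"
      have "k * e = iexp ((x t - c) / real (Suc n))"
        unfolding k_def e_def character_def iexp_add[symmetric] by (simp add: diff_divide_distrib)
      then have "Im (k * e) = sin ((x t - c) / real (Suc n))"
        by (simp only: Im_exp Re_i_times Im_i_times Im_complex_of_real Re_complex_of_real) simp
      moreover have "Re (- \<i> * k / 2 * e) = Im (k * e) / 2" by (simp add: field_simps)
      ultimately show "trig_poly {t} [(1 / 2, \<lambda>_. 0),
          (- \<i> * iexp (- c / real (Suc n)) / 2, \<lambda>_. 1 / real (Suc n))] x = z n x"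
        unfolding z_def k_def[symmetric] trig_poly_Cons fst_conv snd_conv e_def[symmetric]
        by (simp add: add_divide_distrib)
    next
      show "0 \<le> z n x \<and> z n x \<le> 1" for x
      proof -
        have "0 \<le> (1 + s) / 2 \<and> (1 + s) / 2 \<le> 1" if "- 1 \<le> s" "s \<le> 1" for s :: real
          using that by simp
        then show ?thesis unfolding z_def using sin_ge_minus_one sin_le_one by blast
      qed
    qed auto
    then have appr: "approximable (indicator {x. z n x < 1 / 2})" for n
      by (intro approximable_sublevel approximable_member)
    have "approximable (indicator {x. x t < c})"
    proof (rule approximable_lim[OF appr])
      fix x :: "'t \<Rightarrow> real"
      obtain k where k: "\<bar>x t - c\<bar> < real k" using reals_Archimedean2 by blast
      have "(indicator {x. z n x < 1 / 2} x :: real) = indicator {x. x t < c} x" if "n \<ge> k" for n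
      proof -
        define y where "y = (x t - c) / real (Suc n)"
        have "\<bar>x t - c\<bar> < real (Suc n)" using k that by linarith
        then have "\<bar>y\<bar> < 1" unfolding y_def by (simp add: abs_divide)
        then have y: "- pi < y" "y < pi" using pi_gt3 by auto
        have "sin y < 0 \<longleftrightarrow> y < 0"
          using sin_gt_zero[of y] sin_gt_zero[of "- y"] y by (cases y "0::real" rule: linorder_cases) auto
        also have "\<dots> \<longleftrightarrow> x t < c" unfolding y_def by (simp add: divide_less_0_iff)
        finally show ?thesis by (simp add: z_def y_def indicator_def)
      qed
      then have "eventually (\<lambda>n. indicator {x. x t < c} x = (indicator {x. z n x < 1 / 2} x :: real)) sequentially"
        unfolding eventually_sequentially by metis
      then show "(\<lambda>n. indicator {x. z n x < 1 / 2} x) \<longlonglongrightarrow> (indicator {x. x t < c} x :: real)"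
        by (rule Lim_transform_eventually[OF tendsto_const])
    qed
    moreover have "{x. x t < c} \<in> sets cylindrical"
    proof -
      have "{x \<in> space cylindrical. x t < c} \<in> sets cylindrical" by measurable
      then show ?thesis by (simp add: space_PiM)
    qed
    ultimately show ?thesis by simp
  qed
  \<comment> \<open>The identity from \<open>L\<close> to the path space is measurable, since its coordinates are.\<close>
  define L where "L = measure_of UNIV ?A (\<lambda>_. 0)"
  have L: "sets L = ?A" "space L = UNIV" unfolding L_def by simp_all
  have "(\<lambda>x. x) \<in> measurable L cylindrical"
  proof (rule measurable_PiM_single')
    show "(\<lambda>x. x t) \<in> borel_measurable L" for t
      unfolding borel_measurable_iff_less L using half_line by simp
  qed (auto simp: space_PiM)
  then have "(\<lambda>x. x) -` B \<inter> space L \<in> sets L" using B by (rule measurable_sets)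
  then have "approximable (indicator B)" by (simp add: L)
  then show ?thesis using approximableD e by blast
qed

section \<open>Multipliers that preserve nonnegative trigonometric polynomials\<close>

definition multiply :: "(('t \<Rightarrow> real) \<Rightarrow> complex) \<Rightarrow> (complex \<times> ('t \<Rightarrow> real)) list \<Rightarrow> (complex \<times> ('t \<Rightarrow> real)) list" where
  "multiply m p = map (\<lambda>(c, a). (c * m a, a)) p"

text \<open>
  The convolution operator of a positive measure has its Fourier transform as multiplier and is
  positive in this sense.  Positivity of multipliers thus replaces positivity of measures, and a
  limit of positive multipliers need not be known to come from a measure.
\<close>
definition positive_multiplier :: "'t set \<Rightarrow> (('t \<Rightarrow> real) \<Rightarrow> complex) \<Rightarrow> bool" where
  "positive_multiplier I m \<longleftrightarrow>
     (\<forall>p. (\<forall>x. 0 \<le> trig_poly I p x) \<longrightarrow> (\<forall>x. 0 \<le> trig_poly I (multiply m p) x))"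

lemma positive_multiplierD:
  "positive_multiplier I m \<Longrightarrow> (\<And>x. 0 \<le> trig_poly I p x) \<Longrightarrow> 0 \<le> trig_poly I (multiply m p) x"
  unfolding positive_multiplier_def by blast

lemma multiply_Nil [simp]: "multiply m [] = []"
  and multiply_Cons [simp]: "multiply m ((c, a) # p) = (c * m a, a) # multiply m p"
  by (simp_all add: multiply_def)

lemma trig_poly_multiply_add:
  "trig_poly I (multiply (\<lambda>a. m a + n a) p) x = trig_poly I (multiply m p) x + trig_poly I (multiply n p) x"
  by (induction p) (auto simp: algebra_simps)

lemma Re_mult_of_real: "Re (of_real r * z) = r * Re z"
  by simp

lemma trig_poly_multiply_of_real:
  "trig_poly I (multiply (\<lambda>a. of_real r * m a) p) x = r * trig_poly I (multiply m p) x"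
proof (induction p)
  case (Cons ca p)
  obtain c a where ca: "ca = (c, a)" by force
  have "c * (of_real r * m a) * character I a x = of_real r * (c * m a * character I a x)"
    by simp
  then have "Re (c * (of_real r * m a) * character I a x) = r * Re (c * m a * character I a x)"
    by (simp only: Re_mult_of_real)
  then show ?case using Cons by (simp only: ca multiply_Cons trig_poly_Cons fst_conv snd_conv distrib_left)
qed simp

lemma multiply_multiply: "multiply m (multiply n p) = multiply (\<lambda>a. m a * n a) p"
  by (induction p) (auto simp: mult_ac)

lemma tendsto_trig_poly_multiply:
  assumes "\<And>a. ((\<lambda>k. m k a) \<longlongrightarrow> n a) F"
  shows "((\<lambda>k. trig_poly I (multiply (m k) p) x) \<longlongrightarrow> trig_poly I (multiply n p) x) F"
  by (induction p) (auto intro!: tendsto_intros assms)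

lemma positive_multiplier_add:
  "positive_multiplier I m \<Longrightarrow> positive_multiplier I n \<Longrightarrow> positive_multiplier I (\<lambda>a. m a + n a)"
  unfolding positive_multiplier_def trig_poly_multiply_add by simp

lemma positive_multiplier_scale:
  "0 \<le> r \<Longrightarrow> positive_multiplier I m \<Longrightarrow> positive_multiplier I (\<lambda>a. of_real r * m a)"
  unfolding positive_multiplier_def trig_poly_multiply_of_real by simp

lemma positive_multiplier_mult:
  "positive_multiplier I m \<Longrightarrow> positive_multiplier I n \<Longrightarrow> positive_multiplier I (\<lambda>a. m a * n a)"
  unfolding positive_multiplier_def multiply_multiply[symmetric] by simp

lemma positive_multiplier_one: "positive_multiplier I (\<lambda>_. 1)"
proof -
  have "multiply (\<lambda>_. 1) p = p" for p :: "(complex \<times> ('a \<Rightarrow> real)) list" by (induction p) auto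
  then show ?thesis unfolding positive_multiplier_def by simp
qed

lemma positive_multiplier_of_real: "0 \<le> r \<Longrightarrow> positive_multiplier I (\<lambda>_. of_real r)"
  using positive_multiplier_scale[OF _ positive_multiplier_one] by fastforce

lemma positive_multiplier_lim:
  fixes m :: "nat \<Rightarrow> ('t \<Rightarrow> real) \<Rightarrow> complex"
  assumes "\<And>k. positive_multiplier I (m k)" "\<And>a. (\<lambda>k. m k a) \<longlonglongrightarrow> n a"
  shows "positive_multiplier I n"
  unfolding positive_multiplier_def
proof (intro allI impI)
  fix p x assume "\<forall>x. 0 \<le> trig_poly I p x"
  then have "0 \<le> trig_poly I (multiply (m k) p) x" for k using assms(1) positive_multiplierD by blast
  then show "0 \<le> trig_poly I (multiply n p) x"
    by (intro LIMSEQ_le_const[OF tendsto_trig_poly_multiply[OF assms(2)]]) auto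
qed

text \<open>
  The case of all coefficients \<open>1 / k!\<close> is the passage from a measure to the compound Poisson law
  that it generates, up to normalisation.
\<close>
lemma positive_multiplier_powser:
  assumes m: "positive_multiplier I m" and c: "\<And>k. 0 \<le> c k"
    and sums: "\<And>a. (\<lambda>k. of_real (c k) * m a ^ k) sums f a"
  shows "positive_multiplier I f"
proof (rule positive_multiplier_lim)
  have pow: "positive_multiplier I (\<lambda>a. m a ^ k)" for k
    by (induction k) (simp_all add: positive_multiplier_one positive_multiplier_mult[OF m])
  show "positive_multiplier I (\<lambda>a. \<Sum>k<n. of_real (c k) * m a ^ k)" for n
  proof (induction n)
    case 0
    show ?case using positive_multiplier_of_real[of 0 I] by simp
  next
    case (Suc n)
    then show ?case using positive_multiplier_add[OF Suc positive_multiplier_scale[OF c pow]] by simp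
  qed
  show "(\<lambda>n. \<Sum>k<n. of_real (c k) * m a ^ k) \<longlonglongrightarrow> f a" for a using sums[of a] by (simp add: sums_def)
qed

lemma exp_sums_div_fact: "(\<lambda>k. of_real (1 / fact k) * z ^ k) sums exp (z :: complex)"
  using exp_converges[of z] by (simp add: scaleR_conv_of_real divide_inverse mult.commute)

lemma positive_multiplier_exp:
  assumes "positive_multiplier I m" shows "positive_multiplier I (\<lambda>a. exp (m a))"
  by (rule positive_multiplier_powser[OF assms _ exp_sums_div_fact]) simp

text \<open>
  This multiplier is a translation by \<open>d\<close>.
\<close>
lemma positive_multiplier_character: "positive_multiplier I (\<lambda>a. character I a d)"
proof -
  have "trig_poly I (multiply (\<lambda>a. character I a d) p) x = trig_poly I p (\<lambda>t. d t + x t)" for p x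
    by (induction p) (auto simp: character_translate algebra_simps)
  then show ?thesis unfolding positive_multiplier_def by simp
qed

lemma integrable_weighted_character:
  fixes \<nu> :: "('t \<Rightarrow> real) measure"
  assumes sets: "sets \<nu> = sets cylindrical" and w: "integrable \<nu> w"
  shows "integrable \<nu> (\<lambda>y. of_real (w y) * character I a y)"
proof (rule Bochner_Integration.integrable_bound[OF w])
  have [measurable]: "w \<in> borel_measurable \<nu>" using w by auto
  have [measurable]: "character I a \<in> borel_measurable \<nu>"
    unfolding measurable_cong_sets[OF sets refl] by measurable
  show "(\<lambda>y. of_real (w y) * character I a y) \<in> borel_measurable \<nu>" by measurable
qed (simp add: norm_mult)

text \<open>
  The Fourier transform of the measure \<open>w \<cdot> \<nu>\<close> acts as averaging over translates.  Integrability is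
  carried along in the conclusion since the induction needs it to split the integral.
\<close>
lemma trig_poly_multiply_integral:
  fixes \<nu> :: "('t \<Rightarrow> real) measure"
  assumes sets: "sets \<nu> = sets cylindrical" and w: "integrable \<nu> w"
  shows "integrable \<nu> (\<lambda>y. w y * trig_poly I p (\<lambda>t. x t + y t)) \<and>
    trig_poly I (multiply (\<lambda>a. \<integral>y. of_real (w y) * character I a y \<partial>\<nu>) p) x =
    (\<integral>y. w y * trig_poly I p (\<lambda>t. x t + y t) \<partial>\<nu>)"
proof (induction p)
  case (Cons ca p)
  obtain c a where ca: "ca = (c, a)" by force
  let ?e = "character I a"
  have i: "integrable \<nu> (\<lambda>y. (c * ?e x) * (of_real (w y) * ?e y))"
    by (intro integrable_mult_right integrable_weighted_character sets w)
  have "of_real (w y) * (c * ?e (\<lambda>t. x t + y t)) = (c * ?e x) * (of_real (w y) * ?e y)" for y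
    by (simp add: character_translate)
  from arg_cong[OF this, of Re]
  have eq: "w y * Re (c * ?e (\<lambda>t. x t + y t)) = Re ((c * ?e x) * (of_real (w y) * ?e y))" for y
    by (simp only: Re_mult_of_real)
  have "c * (\<integral>y. of_real (w y) * ?e y \<partial>\<nu>) * ?e x = (\<integral>y. (c * ?e x) * (of_real (w y) * ?e y) \<partial>\<nu>)"
    by (subst integral_mult_right_zero) (simp add: mult_ac)
  then have "Re (c * (\<integral>y. of_real (w y) * ?e y \<partial>\<nu>) * ?e x) = Re (\<integral>y. (c * ?e x) * (of_real (w y) * ?e y) \<partial>\<nu>)"
    by (rule arg_cong)
  also have "\<dots> = (\<integral>y. w y * Re (c * ?e (\<lambda>t. x t + y t)) \<partial>\<nu>)"
    unfolding eq by (rule integral_Re[OF i, symmetric])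
  finally have 1: "Re (c * (\<integral>y. of_real (w y) * ?e y \<partial>\<nu>) * ?e x) =
    (\<integral>y. w y * Re (c * ?e (\<lambda>t. x t + y t)) \<partial>\<nu>)" .
  have 2: "integrable \<nu> (\<lambda>y. w y * Re (c * ?e (\<lambda>t. x t + y t)))"
    unfolding eq by (rule integrable_Re[OF i])
  show ?case using Cons 2
    by (simp only: ca multiply_Cons trig_poly_Cons fst_conv snd_conv distrib_left 1
        Bochner_Integration.integral_add Bochner_Integration.integrable_add simp_thms)
qed simp

lemma positive_multiplier_integral:
  fixes \<nu> :: "('t \<Rightarrow> real) measure"
  assumes "sets \<nu> = sets cylindrical" "integrable \<nu> w" "\<And>y. 0 \<le> w y"
  shows "positive_multiplier I (\<lambda>a. \<integral>y. of_real (w y) * character I a y \<partial>\<nu>)"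
  unfolding positive_multiplier_def trig_poly_multiply_integral[OF assms(1,2), THEN conjunct2]
  using assms(3) by (intro allI impI integral_nonneg_AE) auto

text \<open>
  The frequency zero belongs to the constants, so \<open>m 0\<close> is the value of the operator on the constant
  one; apply positivity to one minus the given polynomial.
\<close>
lemma trig_poly_multiply_le:
  assumes m: "positive_multiplier I m" and "\<And>x. trig_poly I p x \<le> 1"
  shows "trig_poly I (multiply m p) x \<le> Re (m (\<lambda>_. 0))"
proof -
  have minus: "trig_poly I (map (\<lambda>(c, a). (- c, a)) q) x = - trig_poly I q x" for q x
    by (induction q) auto
  have comm: "multiply m (map (\<lambda>(c, a). (- c, a)) p) = map (\<lambda>(c, a). (- c, a)) (multiply m p)"
    by (induction p) auto
  have "0 \<le> trig_poly I (multiply m ((1, \<lambda>_. 0) # map (\<lambda>(c, a). (- c, a)) p)) x"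
    by (rule positive_multiplierD[OF m]) (use assms(2) in \<open>simp add: minus\<close>)
  then show ?thesis by (simp add: comm minus)
qed

text \<open>
  Completing the square in one variable at a time.  For a new index \<open>i\<close> with \<open>d = S i i > 0\<close> the
  form splits into one square and the form of the Schur complement on the remaining indices.  If
  \<open>d = 0\<close>, nonnegativity forces the mixed terms with \<open>i\<close> to vanish; division by zero being zero, the
  same formulas then hold.
\<close>
lemma quadratic_form_sum_squares:
  fixes S :: "'t \<Rightarrow> 't \<Rightarrow> real"
  assumes "finite I" "\<And>s t. S s t = S t s" "\<And>a. 0 \<le> (\<Sum>s\<in>I. \<Sum>t\<in>I. a s * a t * S s t)"
  shows "\<exists>V. \<forall>a. (\<Sum>s\<in>I. \<Sum>t\<in>I. a s * a t * S s t) = (\<Sum>v\<leftarrow>V. (\<Sum>t\<in>I. a t * v t)\<^sup>2)"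
  using assms
proof (induction I arbitrary: S rule: finite_induct)
  case empty
  show ?case by (rule exI[of _ "[]"]) simp
next
  case (insert i I)
  note sym = insert.prems(1) and nonneg = insert.prems(2)
  define d where "d = S i i"
  define l where "l a = (\<Sum>t\<in>I. a t * S t i)" for a
  define Q where "Q a = (\<Sum>s\<in>I. \<Sum>t\<in>I. a s * a t * S s t)" for a
  have expand: "(\<Sum>s\<in>insert i I. \<Sum>t\<in>insert i I. a s * a t * S s t) = d * (a i)\<^sup>2 + 2 * a i * l a + Q a" for a
  proof -
    have 1: "(\<Sum>t\<in>I. a i * a t * S i t) = a i * l a"
      unfolding l_def sum_distrib_left by (rule sum.cong) (simp_all add: sym[of i])
    have 2: "(\<Sum>s\<in>I. a s * a i * S s i) = a i * l a"
      unfolding l_def sum_distrib_left by (rule sum.cong) simp_all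
    have "(\<Sum>s\<in>insert i I. \<Sum>t\<in>insert i I. a s * a t * S s t) =
        a i * a i * S i i + (\<Sum>t\<in>I. a i * a t * S i t) + ((\<Sum>s\<in>I. a s * a i * S s i) + Q a)"
      using insert.hyps by (simp add: sum.distrib Q_def)
    then show ?thesis unfolding 1 2 d_def power2_eq_square by (simp add: algebra_simps)
  qed
  have upd: "l (a(i := r)) = l a" "Q (a(i := r)) = Q a" for a r
    unfolding l_def Q_def using insert.hyps by (auto intro!: sum.cong)
  have nonneg': "0 \<le> d * r\<^sup>2 + 2 * r * l a + Q a" for a r
    using nonneg[of "a(i := r)"] unfolding expand upd by simp
  have d: "0 \<le> d" using nonneg'[of 1 "\<lambda>_. 0"] by (simp add: l_def Q_def)
  have l0: "l a = 0" if "d = 0" for a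
  proof (rule ccontr)
    assume "l a \<noteq> 0"
    \<comment> \<open>At this argument the affine function \<open>2 r l a + Q a\<close> of \<open>r\<close> equals \<open>- 1\<close>.\<close>
    then show False using nonneg'[of "- (Q a + 1) / (2 * l a)" a] that by (simp add: field_simps)
  qed
  \<comment> \<open>the Schur complement of the entry \<open>d\<close>\<close>
  define S' where "S' s t = S s t - S s i * S t i / d" for s t
  have Q': "(\<Sum>s\<in>I. \<Sum>t\<in>I. a s * a t * S' s t) = Q a - (l a)\<^sup>2 / d" for a
  proof -
    have "(l a)\<^sup>2 / d = (\<Sum>s\<in>I. \<Sum>t\<in>I. a s * a t * (S s i * S t i / d))"
      unfolding l_def power2_eq_square sum_product sum_divide_distrib
      by (intro sum.cong refl) simp
    then show ?thesis
      unfolding S'_def Q_def right_diff_distrib sum_subtractf by simp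
  qed
  have Q'_nonneg: "0 \<le> Q a - (l a)\<^sup>2 / d" for a
    \<comment> \<open>For \<open>d > 0\<close> the quadratic function of \<open>r\<close> is minimal at this argument.\<close>
    using nonneg'[of "- l a / d" a] l0[of a] d by (cases "d = 0") (auto simp: power2_eq_square field_simps)
  have "\<exists>V. \<forall>a. (\<Sum>s\<in>I. \<Sum>t\<in>I. a s * a t * S' s t) = (\<Sum>v\<leftarrow>V. (\<Sum>t\<in>I. a t * v t)\<^sup>2)"
  proof (rule insert.IH)
    show "S' s t = S' t s" for s t
      unfolding S'_def using sym[of s t] sym[of s i] sym[of t i] by (simp add: mult.commute)
    show "0 \<le> (\<Sum>s\<in>I. \<Sum>t\<in>I. a s * a t * S' s t)" for a
      unfolding Q' by (rule Q'_nonneg)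
  qed
  then obtain V where V: "\<And>a. Q a - (l a)\<^sup>2 / d = (\<Sum>v\<leftarrow>V. (\<Sum>t\<in>I. a t * v t)\<^sup>2)"
    unfolding Q' by blast
  define v where "v t = S t i / sqrt d" for t
  have v: "(\<Sum>t\<in>insert i I. a t * v t) = a i * sqrt d + l a / sqrt d" for a
  proof -
    have "v i = sqrt d" unfolding v_def d_def[symmetric] using d by (rule real_div_sqrt)
    moreover have "(\<Sum>t\<in>I. a t * v t) = l a / sqrt d"
      unfolding v_def l_def sum_divide_distrib by simp
    ultimately show ?thesis using insert.hyps by simp
  qed
  have w: "(\<Sum>t\<in>insert i I. a t * (w(i := 0)) t) = (\<Sum>t\<in>I. a t * w t)" for a w :: "'t \<Rightarrow> real"
    by (rule sum.mono_neutral_cong_right) (use insert.hyps in auto)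
  have "d * (a i)\<^sup>2 + 2 * a i * l a + Q a = (a i * sqrt d + l a / sqrt d)\<^sup>2 + (Q a - (l a)\<^sup>2 / d)" for a
    using d l0[of a] by (cases "d = 0") (auto simp: power2_sum power_mult_distrib power_divide)
  then show ?case
    unfolding expand
    by (intro exI[of _ "v # map (\<lambda>w. w(i := 0)) V"]) (simp add: v w V comp_def del: sum.insert fun_upd_apply)
qed

text \<open>
  A one-dimensional Gaussian law is a limit of compound Poisson laws with jumps \<open>\<plusminus> v / n\<close>, each at
  rate \<open>n\<^sup>2 / 2\<close>: the exponent is \<open>n\<^sup>2 (cos (u / n) - 1)\<close>, which tends to \<open>- u\<^sup>2 / 2\<close>.
\<close>
lemma positive_multiplier_exp_square:
  "positive_multiplier I (\<lambda>a. of_real (exp (- ((\<Sum>t\<in>I. a t * v t)\<^sup>2 / 2))))"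
proof (rule positive_multiplier_lim)
  let ?u = "\<lambda>a :: 'a \<Rightarrow> real. \<Sum>t\<in>I. a t * v t"
  define e where "e n r a = character I a (\<lambda>t. r * v t / real n)" for n r and a :: "'a \<Rightarrow> real"
  show "positive_multiplier I (\<lambda>a. of_real (exp (- (real n)\<^sup>2)) *
      exp (of_real ((real n)\<^sup>2 / 2) * (e n 1 a + e n (-1) a)))" for n
    unfolding e_def
    by (intro positive_multiplier_scale positive_multiplier_exp positive_multiplier_add
        positive_multiplier_character) auto
  fix a :: "'a \<Rightarrow> real"
  have e: "e n r a = iexp (r * (?u a / real n))" for n r
    unfolding e_def character_def sum_divide_distrib sum_distrib_left
    by (rule arg_cong[where f = iexp]) (simp add: mult_ac)
  have "e n 1 a + e n (-1) a = of_real (2 * cos (?u a / real n))" for n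
    unfolding e by (simp add: complex_eq_iff Re_exp Im_exp del: of_real_sum of_real_mult of_real_divide)
  then have "of_real (exp (- (real n)\<^sup>2)) * exp (of_real ((real n)\<^sup>2 / 2) * (e n 1 a + e n (-1) a)) =
      (of_real (exp ((real n)\<^sup>2 * (cos (?u a / real n) - 1))) :: complex)" for n
    by (simp only: of_real_mult[symmetric] exp_of_real exp_add[symmetric]) (simp add: algebra_simps)
  moreover have "(\<lambda>n. exp ((real n)\<^sup>2 * (cos (u / real n) - 1))) \<longlonglongrightarrow> exp (- (u\<^sup>2 / 2))" for u :: real
    unfolding power2_eq_square[of u] by real_asymp
  ultimately show "(\<lambda>n. of_real (exp (- (real n)\<^sup>2)) *
      exp (of_real ((real n)\<^sup>2 / 2) * (e n 1 a + e n (-1) a))) \<longlonglongrightarrow> of_real (exp (- ((?u a)\<^sup>2 / 2)))"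
    by (simp only: tendsto_of_real)
qed

lemma positive_multiplier_gaussian:
  assumes "finite I" "nonneg_definite \<Sigma>"
  shows "positive_multiplier I (\<lambda>a. exp (- complex_of_real ((\<Sum>s\<in>I. \<Sum>t\<in>I. a s * a t * \<Sigma> s t) / 2)))"
proof -
  obtain V where V: "\<forall>a. (\<Sum>s\<in>I. \<Sum>t\<in>I. a s * a t * \<Sigma> s t) = (\<Sum>v\<leftarrow>V. (\<Sum>t\<in>I. a t * v t)\<^sup>2)"
    using quadratic_form_sum_squares[OF assms(1), of \<Sigma>] assms unfolding nonneg_definite_def by blast
  have "positive_multiplier I (\<lambda>a. of_real (exp (- ((\<Sum>v\<leftarrow>V. (\<Sum>t\<in>I. a t * v t)\<^sup>2) / 2))))"
  proof (induction V)
    case Nil show ?case using positive_multiplier_one by simp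
  next
    case (Cons v V)
    have "exp (- ((x + y) / 2)) = exp (- (x / 2)) * exp (- (y / 2))" for x y :: real
      by (simp add: exp_add[symmetric] add_divide_distrib)
    then show ?case using positive_multiplier_mult[OF positive_multiplier_exp_square[of I v] Cons]
      by simp
  qed
  then show ?thesis unfolding V[rule_format] by (simp add: exp_of_real[symmetric])
qed

section \<open>Multipliers from the Levy-Khintchine formula\<close>

definition small_jump :: "real \<Rightarrow> real" where
  "small_jump r = r * indicator {y. \<bar>y\<bar> \<le> 1} r"

lemma small_jump_measurable [measurable]: "small_jump \<in> borel_measurable borel"
  unfolding small_jump_def[abs_def] by measurable

lemma abs_small_jump_le: "\<bar>small_jump r\<bar> \<le> 1"
  by (simp add: small_jump_def indicator_def)

definition jump_size :: "'t set \<Rightarrow> ('t \<Rightarrow> real) \<Rightarrow> real" where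
  "jump_size I x = (\<Sum>t\<in>I. min (\<bar>x t\<bar>\<^sup>2) 1)"

lemma jump_size_nonneg: "0 \<le> jump_size I x"
  unfolding jump_size_def by (intro sum_nonneg) simp

lemma jump_size_ge: "finite I \<Longrightarrow> t \<in> I \<Longrightarrow> min (\<bar>x t\<bar>\<^sup>2) 1 \<le> jump_size I x"
  unfolding jump_size_def by (rule member_le_sum) auto

definition levy_integrand :: "'t set \<Rightarrow> ('t \<Rightarrow> real) \<Rightarrow> ('t \<Rightarrow> real) \<Rightarrow> complex" where
  "levy_integrand I a x = character I a x - 1 - \<i> * of_real (\<Sum>t\<in>I. a t * small_jump (x t))"

text \<open>
  If all jumps are at most one, the compensator equals the linear term and the remainder is
  quadratic; otherwise the jump size is at least one and the integrand is bounded.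
\<close>
lemma norm_levy_integrand_le:
  assumes I: "finite I"
  defines "A \<equiv> \<lambda>a. \<Sum>t\<in>I. \<bar>a t\<bar>"
  shows "norm (levy_integrand I a x) \<le> (2 + A a + (A a)\<^sup>2) * jump_size I x"
proof -
  have A: "0 \<le> A a" unfolding A_def by (intro sum_nonneg) simp
  show ?thesis
  proof (cases "\<forall>t\<in>I. \<bar>x t\<bar> \<le> 1")
    case True
    define u where "u = (\<Sum>t\<in>I. a t * x t)"
    have "(\<Sum>t\<in>I. a t * small_jump (x t)) = u"
      unfolding u_def using True by (intro sum.cong) (auto simp: small_jump_def)
    then have "norm (levy_integrand I a x) = norm (iexp u - (\<Sum>k\<le>1. (\<i> * u) ^ k / fact k))"
      unfolding levy_integrand_def character_def u_def[symmetric] by (simp add: diff_diff_eq)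
    also have "\<dots> \<le> \<bar>u\<bar> ^ Suc 1 / fact (Suc 1)" by (rule iexp_approx1)
    also have "\<dots> \<le> \<bar>u\<bar>\<^sup>2" by (simp add: power2_eq_square)
    also have "\<dots> \<le> (A a * sqrt (jump_size I x))\<^sup>2"
    proof (rule power_mono)
      have "\<bar>a t * x t\<bar> \<le> \<bar>a t\<bar> * sqrt (jump_size I x)" if t: "t \<in> I" for t
      proof -
        have "\<bar>x t\<bar> \<le> 1" using True t by blast
        then have "\<bar>x t\<bar>\<^sup>2 \<le> 1" by (simp add: abs_square_le_1)
        then have "\<bar>x t\<bar>\<^sup>2 \<le> jump_size I x" using jump_size_ge[OF I t, of x] by simp
        then have "\<bar>x t\<bar> \<le> sqrt (jump_size I x)" by (simp add: real_le_rsqrt)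
        then show ?thesis by (simp add: abs_mult mult_left_mono)
      qed
      then show "\<bar>u\<bar> \<le> A a * sqrt (jump_size I x)"
        unfolding u_def A_def sum_distrib_right by (intro order_trans[OF sum_abs sum_mono])
    qed simp
    also have "\<dots> = (A a)\<^sup>2 * jump_size I x" by (simp add: power_mult_distrib jump_size_nonneg)
    also have "\<dots> \<le> (2 + A a + (A a)\<^sup>2) * jump_size I x"
      using A jump_size_nonneg[of I x] by (intro mult_right_mono) auto
    finally show ?thesis .
  next
    case False
    then obtain t where t: "t \<in> I" "\<bar>x t\<bar> > 1" by auto
    then have "1 \<le> \<bar>x t\<bar>\<^sup>2" by (intro one_le_power) simp
    then have js: "1 \<le> jump_size I x" using jump_size_ge[OF I t(1), of x] by simp
    have "\<bar>\<Sum>t\<in>I. a t * small_jump (x t)\<bar> \<le> A a"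
      unfolding A_def
    proof (intro order_trans[OF sum_abs sum_mono])
      fix t show "\<bar>a t * small_jump (x t)\<bar> \<le> \<bar>a t\<bar>"
        using mult_left_mono[OF abs_small_jump_le[of "x t"], of "\<bar>a t\<bar>"] by (simp add: abs_mult)
    qed
    moreover have "norm (levy_integrand I a x) \<le>
        norm (character I a x) + norm (1 :: complex) + norm (\<i> * complex_of_real (\<Sum>t\<in>I. a t * small_jump (x t)))"
      unfolding levy_integrand_def by (meson norm_triangle_ineq4 order_trans add_right_mono)
    ultimately have "norm (levy_integrand I a x) \<le> (2 + A a) * 1"
      by (simp add: norm_mult del: of_real_sum)
    also have "\<dots> \<le> (2 + A a + (A a)\<^sup>2) * jump_size I x"
      using A js by (intro mult_mono) auto
    finally show ?thesis .
  qed
qed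

text \<open>
  This is the jump part of the characteristic function of the process divided by the
  characteristic function of the compound Poisson law with Levy measure \<open>h \<cdot> \<nu>\<close>.  Its own Levy
  measure \<open>(1 - h) \<cdot> \<nu>\<close> may be infinite near zero.  Weights \<open>w\<^sub>k = min 1 (k \<cdot> jump_size)\<close> make it
  finite and increase to one off the paths that vanish on \<open>I\<close>, where the integrand is zero.  For the
  weighted measure the compensator can be split off as a shift \<open>d k\<close>, and what remains is compound
  Poisson.
\<close>
lemma positive_multiplier_levy_quotient:
  fixes \<nu> :: "('t \<Rightarrow> real) measure"
  assumes sets: "sets \<nu> = sets cylindrical" and I: "finite I"
    and jumps: "\<And>t. integrable \<nu> (\<lambda>x. min (\<bar>x t\<bar>\<^sup>2) 1)"
    and h: "integrable \<nu> h" "\<And>x. 0 \<le> h x" "\<And>x. h x \<le> 1"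
  shows "positive_multiplier I (\<lambda>a. exp ((\<integral>x. levy_integrand I a x \<partial>\<nu>) -
    ((\<integral>x. of_real (h x) * character I a x \<partial>\<nu>) - of_real (\<integral>x. h x \<partial>\<nu>))))"
proof (rule positive_multiplier_lim)
  note meas = measurable_cong_sets[OF sets refl]
  have [measurable]: "h \<in> borel_measurable \<nu>" using h(1) by auto
  have [measurable]: "character I a \<in> borel_measurable \<nu>" for a
    unfolding meas by measurable
  have [measurable]: "(\<lambda>x. x t) \<in> borel_measurable \<nu>" for t
    unfolding meas by measurable
  have [measurable]: "(\<lambda>x. jump_size I x) \<in> borel_measurable \<nu>"
    unfolding jump_size_def by measurable
  have int_js: "integrable \<nu> (\<lambda>x. jump_size I x)"
    unfolding jump_size_def by (intro Bochner_Integration.integrable_sum jumps)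
  define w where "w k x = min 1 (real k * jump_size I x)" for k x
  have w0: "0 \<le> w k x" and w1: "w k x \<le> 1" for k x
    unfolding w_def using jump_size_nonneg[of I x] by auto
  have [measurable]: "(\<lambda>x. w k x) \<in> borel_measurable \<nu>" for k unfolding w_def by measurable
  have w: "integrable \<nu> (w k)" for k
    by (rule Bochner_Integration.integrable_bound[OF integrable_mult_right[OF int_js, of "real k"]])
      (use w0[of k] in \<open>auto simp: w_def jump_size_nonneg\<close>)
  have wbound: "integrable \<nu> (\<lambda>x. w k x * f x)"
    if [measurable]: "f \<in> borel_measurable \<nu>" and "\<And>x. \<bar>f x\<bar> \<le> 1" for f k
    by (rule Bochner_Integration.integrable_bound[OF w[of k]])
      (use that(2) w0[of k] in \<open>auto simp: abs_mult mult_left_le\<close>)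
  have wh: "integrable \<nu> (\<lambda>x. w k x * h x)" "integrable \<nu> (\<lambda>x. w k x * (1 - h x))" for k
    using h by (intro wbound; simp add: abs_le_iff)+
  have wj: "integrable \<nu> (\<lambda>x. w k x * small_jump (x t))" for k t
    by (intro wbound abs_small_jump_le) measurable
  define d where "d k t = (\<integral>x. w k x * small_jump (x t) \<partial>\<nu>)" for k t
  define m where "m k a = of_real (exp (- (\<integral>x. w k x * (1 - h x) \<partial>\<nu>))) *
    exp (\<integral>x. of_real (w k x * (1 - h x)) * character I a x \<partial>\<nu>) * character I a (\<lambda>t. - d k t)" for k a
  show "positive_multiplier I (m k)" for k
    unfolding m_def
    by (intro positive_multiplier_mult[OF _ positive_multiplier_character] positive_multiplier_scale
        positive_multiplier_exp positive_multiplier_integral sets wh) (simp_all add: w0 h)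
  have [measurable]: "levy_integrand I a \<in> borel_measurable \<nu>" for a
    unfolding levy_integrand_def[abs_def] by measurable
  have int_levy: "integrable \<nu> (levy_integrand I a)" for a
  proof (rule Bochner_Integration.integrable_bound[OF integrable_mult_right[OF int_js]])
    show "AE x in \<nu>. norm (levy_integrand I a x) \<le>
        norm ((2 + (\<Sum>t\<in>I. \<bar>a t\<bar>) + (\<Sum>t\<in>I. \<bar>a t\<bar>)\<^sup>2) * jump_size I x)"
      unfolding real_norm_def by (intro AE_I2 order_trans[OF norm_levy_integrand_le[OF I] abs_ge_self])
  qed measurable
  have m_eq: "m k a = exp ((\<integral>x. of_real (w k x) * levy_integrand I a x \<partial>\<nu>) -
    (\<integral>x. of_real (w k x * h x) * (character I a x - 1) \<partial>\<nu>))" for k a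
  proof -
    let ?C = "\<lambda>f. \<integral>x. of_real (f x) * character I a x \<partial>\<nu>"
    have i1: "integrable \<nu> (\<lambda>x. of_real (f x) * character I a x)" if "integrable \<nu> f" for f
      using that by (rule integrable_weighted_character[OF sets])
    have 1: "(\<integral>x. of_real (w k x) * levy_integrand I a x \<partial>\<nu>) =
        ?C (w k) - of_real (\<integral>x. w k x \<partial>\<nu>) - \<i> * of_real (\<Sum>t\<in>I. a t * d k t)"
    proof -
      have "(\<integral>x. of_real (w k x) * levy_integrand I a x \<partial>\<nu>) =
        (\<integral>x. of_real (w k x) * character I a x - of_real (w k x) -
          \<i> * of_real (\<Sum>t\<in>I. a t * (w k x * small_jump (x t))) \<partial>\<nu>)"
        unfolding levy_integrand_def
        by (intro Bochner_Integration.integral_cong refl) (simp add: algebra_simps sum_distrib_left)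
      also have "\<dots> = ?C (w k) - (\<integral>x. of_real (w k x) \<partial>\<nu>) -
          (\<integral>x. \<i> * of_real (\<Sum>t\<in>I. a t * (w k x * small_jump (x t))) \<partial>\<nu>)"
        by (intro Bochner_Integration.integral_diff[THEN trans] arg_cong2[where f = minus] refl
            Bochner_Integration.integral_diff Bochner_Integration.integrable_diff i1 w integrable_of_real
            integrable_mult_right Bochner_Integration.integrable_sum wj)
      also have "(\<integral>x. \<i> * complex_of_real (\<Sum>t\<in>I. a t * (w k x * small_jump (x t))) \<partial>\<nu>) =
          \<i> * of_real (\<Sum>t\<in>I. a t * d k t)"
        unfolding integral_mult_right_zero integral_complex_of_real d_def
        by (subst Bochner_Integration.integral_sum) (auto intro: wj)
      finally show ?thesis by (simp only: integral_complex_of_real)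
    qed
    have 2: "(\<integral>x. of_real (w k x * h x) * (character I a x - 1) \<partial>\<nu>) =
        ?C (\<lambda>x. w k x * h x) - of_real (\<integral>x. w k x * h x \<partial>\<nu>)"
      unfolding right_diff_distrib mult_1_right
      by (subst Bochner_Integration.integral_diff) (simp_all only: i1 wh integrable_of_real integral_complex_of_real)
    have 3: "?C (\<lambda>x. w k x * (1 - h x)) = ?C (w k) - ?C (\<lambda>x. w k x * h x)"
      unfolding Bochner_Integration.integral_diff[OF i1[OF w] i1[OF wh(1)], symmetric]
      by (intro Bochner_Integration.integral_cong refl) (simp add: algebra_simps)
    have 4: "(\<integral>x. w k x * (1 - h x) \<partial>\<nu>) = (\<integral>x. w k x \<partial>\<nu>) - (\<integral>x. w k x * h x \<partial>\<nu>)"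
      unfolding right_diff_distrib mult_1_right by (rule Bochner_Integration.integral_diff[OF w wh(1)])
    have 5: "character I a (\<lambda>t. - d k t) = exp (- (\<i> * of_real (\<Sum>t\<in>I. a t * d k t)))"
      unfolding character_def by (simp add: sum_negf)
    show ?thesis
      unfolding m_def 1 2 3 4 5 exp_of_real[symmetric] exp_add[symmetric]
      by (rule arg_cong[where f = exp]) simp
  qed
  fix a :: "'t \<Rightarrow> real"
  have w_lim: "(\<lambda>k. of_real (w k x) * z) \<longlonglongrightarrow> z" if z: "jump_size I x = 0 \<Longrightarrow> z = 0" for x and z :: complex
  proof (cases "jump_size I x = 0")
    case True then show ?thesis using z by simp
  next
    case False
    then have pos: "0 < jump_size I x" using jump_size_nonneg[of I x] by simp
    obtain N where N: "1 / jump_size I x < real N" using reals_Archimedean2 by blast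
    have "z = of_real (w k x) * z" if "k \<ge> N" for k
    proof -
      have "1 / jump_size I x \<le> real k" using N that by linarith
      then have "1 \<le> real k * jump_size I x" using pos by (simp add: field_simps)
      then show ?thesis by (simp add: w_def)
    qed
    then have "eventually (\<lambda>k. z = of_real (w k x) * z) sequentially"
      unfolding eventually_sequentially by blast
    then show ?thesis by (rule Lim_transform_eventually[OF tendsto_const])
  qed
  have lim1: "(\<lambda>k. \<integral>x. of_real (w k x) * levy_integrand I a x \<partial>\<nu>) \<longlonglongrightarrow> (\<integral>x. levy_integrand I a x \<partial>\<nu>)"
  proof (rule integral_dominated_convergence[where w = "\<lambda>x. norm (levy_integrand I a x)"])
    show "AE x in \<nu>. (\<lambda>k. of_real (w k x) * levy_integrand I a x) \<longlonglongrightarrow> levy_integrand I a x"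
      using norm_levy_integrand_le[OF I, of a] by (intro AE_I2 w_lim) (metis mult_zero_right norm_le_zero_iff)
    show "AE x in \<nu>. norm (of_real (w k x) * levy_integrand I a x) \<le> norm (levy_integrand I a x)" for k
      by (intro AE_I2) (simp add: norm_mult w0 w1 mult_left_le_one_le)
  qed (use int_levy in simp_all)
  have int_h: "integrable \<nu> (\<lambda>x. of_real (h x) * (character I a x - 1))"
    unfolding right_diff_distrib mult_1_right
    by (intro Bochner_Integration.integrable_diff integrable_weighted_character sets h integrable_of_real)
  have lim2: "(\<lambda>k. \<integral>x. of_real (w k x * h x) * (character I a x - 1) \<partial>\<nu>) \<longlonglongrightarrow>
      (\<integral>x. of_real (h x) * (character I a x - 1) \<partial>\<nu>)"
  proof (rule integral_dominated_convergence[where w = "\<lambda>x. norm (of_real (h x) * (character I a x - 1))"])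
    have "character I a x = 1" if "jump_size I x = 0" for x
    proof -
      have "x t = 0" if t: "t \<in> I" for t
        using jump_size_ge[OF I t, of x] \<open>jump_size I x = 0\<close> by (auto simp: min_le_iff_disj)
      then show ?thesis unfolding character_def by simp
    qed
    then show "AE x in \<nu>. (\<lambda>k. of_real (w k x * h x) * (character I a x - 1)) \<longlonglongrightarrow>
        of_real (h x) * (character I a x - 1)"
      unfolding of_real_mult mult.assoc by (intro AE_I2 w_lim) simp
    show "AE x in \<nu>. norm (of_real (w k x * h x) * (character I a x - 1)) \<le>
        norm (of_real (h x) * (character I a x - 1))" for k
      by (intro AE_I2) (simp add: norm_mult w0 w1 h abs_mult mult.assoc mult_left_le_one_le)
  qed (use int_h in simp_all)
  have "(\<integral>x. of_real (h x) * (character I a x - 1) \<partial>\<nu>) =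
      (\<integral>x. of_real (h x) * character I a x \<partial>\<nu>) - of_real (\<integral>x. h x \<partial>\<nu>)"
    unfolding right_diff_distrib mult_1_right
    by (subst Bochner_Integration.integral_diff)
      (simp_all add: integrable_weighted_character sets h)
  then show "(\<lambda>k. m k a) \<longlonglongrightarrow> exp ((\<integral>x. levy_integrand I a x \<partial>\<nu>) -
    ((\<integral>x. of_real (h x) * character I a x \<partial>\<nu>) - of_real (\<integral>x. h x \<partial>\<nu>)))"
    unfolding m_eq using tendsto_exp[OF tendsto_diff[OF lim1 lim2]] by simp
qed

text \<open>
  This is the sum of \<open>e\<^sup>-\<^sup>c j c\<^sup>j / j!\<close> over \<open>j > K\<close>.
\<close>
definition poisson_tail :: "real \<Rightarrow> nat \<Rightarrow> real" where
  "poisson_tail c K = c - exp (- c) * (\<Sum>j\<le>K. real j / fact j * c ^ j)"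

lemma sums_mult_exp:
  fixes z :: "'a :: {real_normed_field, banach}"
  shows "(\<lambda>j. of_real (real j / fact j) * z ^ j) sums (z * exp z)"
proof -
  have "(\<lambda>j. z * (z ^ j /\<^sub>R fact j)) sums (z * exp z)" by (intro sums_mult exp_converges)
  also have "(\<lambda>j. z * (z ^ j /\<^sub>R fact j)) = (\<lambda>j. of_real (real (Suc j) / fact (Suc j)) * z ^ Suc j)"
    by (simp add: fun_eq_iff scaleR_conv_of_real fact_Suc divide_inverse mult_ac del: of_nat_Suc)
  finally show ?thesis by (subst (asm) sums_Suc_iff) simp
qed

lemma poisson_tail_tendsto_0: "poisson_tail c \<longlonglongrightarrow> 0"
proof -
  have "(\<lambda>K. c - exp (- c) * (\<Sum>j\<le>K. real j / fact j * c ^ j)) \<longlonglongrightarrow> c - exp (- c) * (c * exp c)"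
    using sums_mult_exp[of c] unfolding sums_def_le by (intro tendsto_intros) simp
  then show ?thesis by (simp add: poisson_tail_def[abs_def] exp_minus field_simps)
qed

text \<open>
  Here \<open>s\<close> plays the finite measure \<open>\<eta>\<close> of mass \<open>c\<close>, and \<open>q\<close> the law that remains after its
  compound Poisson law is divided out of \<open>\<phi>\<close>.  Expanding \<open>exp s\<close>, the multiplier \<open>s exp s\<close> has the
  coefficients \<open>j / j!\<close>, so both \<open>K exp s - E\<close> and \<open>s exp s - E\<close>, with \<open>E\<close> the part of the latter
  series up to \<open>j = K\<close>, have nonnegative coefficients and are positive multipliers.  The second one
  is bounded by its value at frequency zero.
\<close>
lemma poisson_multiplier_le:
  assumes q: "positive_multiplier I q" and s: "positive_multiplier I s"
    and s0: "s (\<lambda>_. 0) = of_real c" and \<phi>0: "\<phi> (\<lambda>_. 0) = 1"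
    and \<phi>: "\<And>a. \<phi> a = q a * exp (s a - of_real c)"
    and p: "\<And>x. 0 \<le> trig_poly I p x" "\<And>x. trig_poly I p x \<le> 1"
  shows "trig_poly I (multiply (\<lambda>a. \<phi> a * s a) p) x \<le>
    real K * trig_poly I (multiply \<phi> p) x + poisson_tail c K"
proof -
  define E where "E z = (\<Sum>j\<le>K. of_real (real j / fact j) * z ^ j)" for z :: complex
  define D1 where "D1 a = of_real (real K) * exp (s a) - E (s a)" for a
  define D2 where "D2 a = s a * exp (s a) - E (s a)" for a
  have E: "(\<lambda>j. if j \<in> {..K} then of_real (real j / fact j) * z ^ j else 0) sums E z" for z
    unfolding E_def by (rule sums_If_finite_set) simp
  have D1: "positive_multiplier I D1"
  proof (rule positive_multiplier_powser[OF s])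
    show "0 \<le> real K / fact j - (if j \<le> K then real j / fact j else 0)" for j
      by (auto intro: divide_right_mono)
    have eq: "of_real (real K / fact j - (if j \<le> K then real j / fact j else 0)) * s a ^ j =
        of_real (real K) * (of_real (1 / fact j) * s a ^ j) -
        (if j \<in> {..K} then of_real (real j / fact j) * s a ^ j else 0)" for j a
      by (simp add: algebra_simps)
    show "(\<lambda>j. of_real (real K / fact j - (if j \<le> K then real j / fact j else 0)) * s a ^ j) sums D1 a" for a
      unfolding eq D1_def by (intro sums_diff sums_mult exp_sums_div_fact E)
  qed
  have D2: "positive_multiplier I D2"
  proof (rule positive_multiplier_powser[OF s])
    show "0 \<le> (if j \<le> K then 0 else real j / fact j)" for j by simp
    have eq: "of_real (if j \<le> K then 0 else real j / fact j) * s a ^ j =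
        of_real (real j / fact j) * s a ^ j -
        (if j \<in> {..K} then of_real (real j / fact j) * s a ^ j else 0)" for j a
      by simp
    show "(\<lambda>j. of_real (if j \<le> K then 0 else real j / fact j) * s a ^ j) sums D2 a" for a
      unfolding eq D2_def by (intro sums_diff sums_mult_exp E)
  qed
  have q0: "q (\<lambda>_. 0) = 1" using \<phi>[of "\<lambda>_. 0"] \<phi>0 s0 by simp
  let ?T = "\<lambda>m. trig_poly I (multiply m p) x"
  define R where "R D a = of_real (exp (- c)) * (q a * D a)" for D :: "('a \<Rightarrow> real) \<Rightarrow> complex" and a
  have "\<phi> a * s a + R D1 a = of_real (real K) * \<phi> a + R D2 a" for a
    unfolding \<phi> R_def D1_def D2_def exp_diff
    by (simp add: exp_of_real[symmetric] exp_minus field_simps)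
  then have "?T (\<lambda>a. \<phi> a * s a + R D1 a) = ?T (\<lambda>a. of_real (real K) * \<phi> a + R D2 a)" by simp
  then have "?T (\<lambda>a. \<phi> a * s a) + ?T (R D1) = real K * ?T \<phi> + ?T (R D2)"
    unfolding trig_poly_multiply_add trig_poly_multiply_of_real .
  moreover have "0 \<le> ?T (R D1)"
    unfolding R_def
    by (intro positive_multiplierD[OF positive_multiplier_scale[OF _ positive_multiplier_mult[OF q D1]]] p) simp
  moreover have "?T (R D2) \<le> Re (R D2 (\<lambda>_. 0))"
    unfolding R_def
    by (intro trig_poly_multiply_le[OF positive_multiplier_scale[OF _ positive_multiplier_mult[OF q D2]]] p) simp
  moreover have "R D2 (\<lambda>_. 0) = of_real (poisson_tail c K)"
  proof -
    have "E (of_real c) = of_real (\<Sum>j\<le>K. real j / fact j * c ^ j)" unfolding E_def by simp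
    then show ?thesis unfolding R_def D2_def q0 s0 poisson_tail_def
      by (simp add: exp_of_real right_diff_distrib exp_minus del: of_real_sum)
  qed
  ultimately show ?thesis by simp
qed

section \<open>Convolution of laws and absolute continuity\<close>

definition law_convolution :: "('t \<Rightarrow> real) measure \<Rightarrow> ('t \<Rightarrow> real) measure \<Rightarrow> ('t \<Rightarrow> real) measure" where
  "law_convolution \<mu> \<eta> = distr (\<mu> \<Otimes>\<^sub>M \<eta>) cylindrical (\<lambda>(x, y) t. x t + y t)"

lemma measurable_path_sum:
  assumes "sets \<mu> = sets cylindrical" "sets \<eta> = sets cylindrical"
  shows "(\<lambda>(x, y) t. x t + y t) \<in> measurable (\<mu> \<Otimes>\<^sub>M \<eta>) (cylindrical :: ('t \<Rightarrow> real) measure)"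
proof -
  have "(\<lambda>z t. fst z t + snd z t) \<in> measurable (cylindrical \<Otimes>\<^sub>M cylindrical) (cylindrical :: ('t \<Rightarrow> real) measure)"
    by (rule measurable_PiM_single') (auto simp: space_PiM)
  then show ?thesis
    unfolding measurable_cong_sets[OF sets_pair_measure_cong[OF assms] refl] case_prod_beta .
qed

lemma space_eq_UNIV:
  assumes "sets \<mu> = sets (cylindrical :: ('t \<Rightarrow> real) measure)"
  shows "space \<mu> = UNIV"
  using sets_eq_imp_space_eq[OF assms] by (simp add: space_PiM)

text \<open>
  By Fubini, a set is null for the convolution iff almost all of its translates are \<open>\<mu>\<close>-null.
\<close>
lemma absolutely_continuous_law_convolution:
  assumes \<mu>: "sigma_finite_measure \<mu>" "sets \<mu> = sets cylindrical"
    and \<eta>: "sigma_finite_measure \<eta>" "sets \<eta> = sets cylindrical"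
    and \<rho>: "sigma_finite_measure \<rho>" "sets \<rho> = sets cylindrical"
    and ac: "absolutely_continuous \<eta> \<rho>"
  shows "absolutely_continuous (law_convolution \<mu> \<eta>) (law_convolution \<mu> \<rho>)"
proof -
  have null_iff: "emeasure (law_convolution \<mu> \<kappa>) B = 0 \<longleftrightarrow>
      (AE y in \<kappa>. (\<integral>\<^sup>+ x. indicator B (\<lambda>t. x t + y t) \<partial>\<mu>) = 0)"
    if \<kappa>: "sigma_finite_measure \<kappa>" "sets \<kappa> = sets cylindrical" and B: "B \<in> sets cylindrical" for \<kappa> B
  proof -
    interpret \<mu>: sigma_finite_measure \<mu> by fact
    interpret \<kappa>: sigma_finite_measure \<kappa> by fact
    interpret P: pair_sigma_finite \<mu> \<kappa> ..
    note [measurable] = measurable_path_sum[OF \<mu>(2) \<kappa>(2)] B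
    let ?f = "\<lambda>z. indicator B (case z of (x, y) \<Rightarrow> \<lambda>t. x t + y t) :: ennreal"
    have f: "?f \<in> borel_measurable (\<mu> \<Otimes>\<^sub>M \<kappa>)" by measurable
    have "emeasure (law_convolution \<mu> \<kappa>) B = (\<integral>\<^sup>+ z. indicator B z \<partial>law_convolution \<mu> \<kappa>)"
      using B by (simp add: law_convolution_def)
    also have "\<dots> = (\<integral>\<^sup>+ z. ?f z \<partial>(\<mu> \<Otimes>\<^sub>M \<kappa>))"
      unfolding law_convolution_def by (rule nn_integral_distr) measurable
    also have "\<dots> = (\<integral>\<^sup>+ y. \<integral>\<^sup>+ x. indicator B (\<lambda>t. x t + y t) \<partial>\<mu> \<partial>\<kappa>)"
      using P.nn_integral_snd[OF f] by simp
    finally have eq: "emeasure (law_convolution \<mu> \<kappa>) B = \<dots>" .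
    have "(\<lambda>y. \<integral>\<^sup>+ x. ?f (x, y) \<partial>\<mu>) \<in> borel_measurable \<kappa>"
      using f by measurable
    then show ?thesis unfolding eq by (subst nn_integral_0_iff_AE) auto
  qed
  show ?thesis
    unfolding absolutely_continuous_def
  proof
    fix B assume "B \<in> null_sets (law_convolution \<mu> \<eta>)"
    then have B: "B \<in> sets cylindrical" and 0: "emeasure (law_convolution \<mu> \<eta>) B = 0"
      by (auto simp: null_sets_def law_convolution_def)
    have "AE y in \<rho>. (\<integral>\<^sup>+ x. indicator B (\<lambda>t. x t + y t) \<partial>\<mu>) = 0"
      using absolutely_continuous_AE[OF _ ac] 0[unfolded null_iff[OF \<eta> B]] \<eta>(2) \<rho>(2) by simp
    then show "B \<in> null_sets (law_convolution \<mu> \<rho>)"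
      using B null_iff[OF \<rho> B] by (auto simp: null_sets_def law_convolution_def)
  qed
qed

lemma integral_character_law_convolution:
  assumes \<mu>: "finite_measure \<mu>" "sets \<mu> = sets cylindrical"
    and \<eta>: "finite_measure \<eta>" "sets \<eta> = sets cylindrical"
  shows "(\<integral>z. character I a z \<partial>law_convolution \<mu> \<eta>) =
    (\<integral>x. character I a x \<partial>\<mu>) * (\<integral>y. character I a y \<partial>\<eta>)"
proof -
  interpret \<mu>: finite_measure \<mu> by fact
  interpret \<eta>: finite_measure \<eta> by fact
  interpret P: pair_sigma_finite \<mu> \<eta> ..
  interpret finite_measure "\<mu> \<Otimes>\<^sub>M \<eta>" by (rule finite_measure_pair_measure[OF \<eta>(1) \<mu>(1)])
  note sum [measurable] = measurable_path_sum[OF \<mu>(2) \<eta>(2)]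
  let ?f = "\<lambda>z. character I a (case z of (x, y) \<Rightarrow> \<lambda>t. x t + y t)"
  have f: "?f \<in> borel_measurable (\<mu> \<Otimes>\<^sub>M \<eta>)"
    by (rule measurable_compose[OF sum character_measurable])
  have int: "integrable (\<mu> \<Otimes>\<^sub>M \<eta>) ?f"
    by (rule integrable_const_bound[where B = 1]) (use f in auto)
  have "(\<integral>z. character I a z \<partial>law_convolution \<mu> \<eta>) = (\<integral>z. ?f z \<partial>(\<mu> \<Otimes>\<^sub>M \<eta>))"
    unfolding law_convolution_def by (rule integral_distr[OF sum character_measurable])
  also have "\<dots> = (\<integral>x. \<integral>y. ?f (x, y) \<partial>\<eta> \<partial>\<mu>)"
    by (rule P.integral_fst'[OF int, symmetric])
  also have "\<dots> = (\<integral>x. character I a x \<partial>\<mu>) * (\<integral>y. character I a y \<partial>\<eta>)"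
    by (simp add: character_translate)
  finally show ?thesis .
qed

lemma integral_trig_poly:
  fixes m :: "('t \<Rightarrow> real) measure"
  assumes "finite_measure m" "sets m = sets cylindrical"
  shows "(\<integral>x. trig_poly I p x \<partial>m) = trig_poly I (multiply (\<lambda>a. \<integral>x. character I a x \<partial>m) p) (\<lambda>_. 0)"
proof -
  interpret finite_measure m by fact
  show ?thesis
    using trig_poly_multiply_integral[OF assms(2), of "\<lambda>_. 1" I p "\<lambda>_. 0"] by simp
qed

text \<open>
  The heart of the argument: the inequality \<open>(\<mu> * \<eta>)(f) \<le> K \<mu>(f) + \<tau>\<^sub>K\<close> for trigonometric
  polynomials passes to cylindrical sets by density, with \<open>K\<close> fixed; for a \<open>\<mu>\<close>-null set only the
  tail remains, and it tends to zero as \<open>K\<close> grows.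
\<close>
lemma absolutely_continuous_convolution_thinned_levy_measure:
  fixes \<mu> \<nu> :: "('t \<Rightarrow> real) measure"
  assumes \<mu>: "prob_space \<mu>" "sets \<mu> = sets cylindrical"
    and \<nu>: "sets \<nu> = sets cylindrical"
    and jumps: "\<And>t. integrable \<nu> (\<lambda>x. min (\<bar>x t\<bar>\<^sup>2) 1)"
    and \<Sigma>: "nonneg_definite \<Sigma>"
    and \<phi>: "\<And>I a. finite I \<Longrightarrow> I \<noteq> {} \<Longrightarrow> (\<integral>x. character I a x \<partial>\<mu>) =
      exp (- complex_of_real ((\<Sum>s\<in>I. \<Sum>t\<in>I. a s * a t * \<Sigma> s t) / 2) +
        (\<integral>x. levy_integrand I a x \<partial>\<nu>) + \<i> * complex_of_real (\<Sum>t\<in>I. a t * b t))"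
    and h: "integrable \<nu> h" "\<And>x. 0 \<le> h x" "\<And>x. h x \<le> 1"
  shows "absolutely_continuous \<mu> (law_convolution \<mu> (density \<nu> (\<lambda>x. ennreal (h x))))"
proof -
  interpret \<mu>: prob_space \<mu> by fact
  have [measurable]: "h \<in> borel_measurable \<nu>" using h(1) by auto
  define \<eta> where "\<eta> = density \<nu> (\<lambda>x. ennreal (h x))"
  have \<eta>_sets: "sets \<eta> = sets cylindrical" unfolding \<eta>_def using \<nu> by simp
  have "emeasure \<eta> (space \<eta>) = (\<integral>\<^sup>+x. ennreal (h x) \<partial>\<nu>)"
    unfolding \<eta>_def by (simp add: emeasure_density)
  also have "\<dots> < \<infinity>" using integrableD(2)[OF h(1)] h(2) by (simp add: less_top)
  finally interpret \<eta>: finite_measure \<eta> by (intro finite_measureI) simp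
  interpret P: finite_measure "\<mu> \<Otimes>\<^sub>M \<eta>"
    by (rule finite_measure_pair_measure[OF \<eta>.finite_measure_axioms \<mu>.finite_measure_axioms])
  define \<kappa> where "\<kappa> = law_convolution \<mu> \<eta>"
  have \<kappa>_sets: "sets \<kappa> = sets cylindrical" unfolding \<kappa>_def law_convolution_def by simp
  have \<kappa>_finite: "finite_measure \<kappa>"
    unfolding \<kappa>_def law_convolution_def
    by (rule P.finite_measure_distr[OF measurable_path_sum[OF \<mu>(2) \<eta>_sets]])
  define c where "c = (\<integral>x. h x \<partial>\<nu>)"
  have le: "(\<integral>z. f z \<partial>\<kappa>) \<le> real K * (\<integral>x. f x \<partial>\<mu>) + poisson_tail c K"
    if fS: "f \<in> unit_trig_polys" for f K
  proof -
    obtain I p where I: "finite I" "I \<noteq> {}" and f: "f = trig_poly I p"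
      and range: "\<And>x. 0 \<le> f x \<and> f x \<le> 1" using unit_trig_polysE[OF fS] by metis
    define s where "s a = (\<integral>y. of_real (h y) * character I a y \<partial>\<nu>)" for a
    define \<phi>' where "\<phi>' a = (\<integral>x. character I a x \<partial>\<mu>)" for a
    \<comment> \<open>the characteristic function of what remains of \<open>\<mu>\<close> without the compound Poisson part of \<open>\<eta>\<close>\<close>
    define q where "q a = exp (- complex_of_real ((\<Sum>s\<in>I. \<Sum>t\<in>I. a s * a t * \<Sigma> s t) / 2)) *
      exp ((\<integral>x. levy_integrand I a x \<partial>\<nu>) - (s a - of_real c)) * character I a b" for a
    have s: "positive_multiplier I s"
      unfolding s_def by (rule positive_multiplier_integral[OF \<nu> h(1,2)])
    have q: "positive_multiplier I q"
      unfolding q_def s_def c_def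
      by (rule positive_multiplier_mult[OF positive_multiplier_mult[OF
            positive_multiplier_gaussian[OF I(1) \<Sigma>]
            positive_multiplier_levy_quotient[OF \<nu> I(1) jumps h]] positive_multiplier_character])
    have s_\<eta>: "(\<integral>y. character I a y \<partial>\<eta>) = s a" for a
    proof -
      have [measurable]: "character I a \<in> borel_measurable \<nu>"
        unfolding measurable_cong_sets[OF \<nu> refl] by measurable
      show ?thesis unfolding s_def \<eta>_def
        by (subst integral_density) (auto simp: h(2) scaleR_conv_of_real)
    qed
    have \<phi>_eq: "\<phi>' a = q a * exp (s a - of_real c)" for a
      unfolding \<phi>'_def \<phi>[OF I] q_def character_def[of I a b] exp_add[symmetric]
      by (rule arg_cong[where f = exp]) simp
    have "(\<integral>z. f z \<partial>\<kappa>) = trig_poly I (multiply (\<lambda>a. \<phi>' a * s a) p) (\<lambda>_. 0)"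
      unfolding f integral_trig_poly[OF \<kappa>_finite \<kappa>_sets] \<phi>'_def s_\<eta>[symmetric]
      unfolding \<kappa>_def by (simp only: integral_character_law_convolution[OF \<mu>.finite_measure_axioms \<mu>(2)
            \<eta>.finite_measure_axioms \<eta>_sets])
    also have "\<dots> \<le> real K * trig_poly I (multiply \<phi>' p) (\<lambda>_. 0) + poisson_tail c K"
    proof (rule poisson_multiplier_le[OF q s])
      show "s (\<lambda>_. 0) = of_real c" unfolding s_def c_def by simp
      have "character I (\<lambda>_. 0) = (\<lambda>_. 1)" by (simp add: fun_eq_iff)
      then show "\<phi>' (\<lambda>_. 0) = 1" unfolding \<phi>'_def by (simp add: \<mu>.prob_space)
      show "\<phi>' a = q a * exp (s a - of_real c)" for a by (rule \<phi>_eq)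
      show "0 \<le> trig_poly I p x" "trig_poly I p x \<le> 1" for x
        using range[of x] unfolding f by blast+
    qed
    also have "trig_poly I (multiply \<phi>' p) (\<lambda>_. 0) = (\<integral>x. f x \<partial>\<mu>)"
      unfolding f integral_trig_poly[OF \<mu>.finite_measure_axioms \<mu>(2)] \<phi>'_def ..
    finally show ?thesis .
  qed
  show ?thesis
    unfolding absolutely_continuous_def \<eta>_def[symmetric] \<kappa>_def[symmetric]
  proof
    fix B assume B_null: "B \<in> null_sets \<mu>"
    then have B: "B \<in> sets cylindrical" using \<mu>(2) by auto
    have measures: "finite_measure m" "sets m = sets cylindrical" if "m \<in> {\<mu>, \<kappa>}" for m
      using that \<mu>.finite_measure_axioms \<kappa>_finite \<mu>(2) \<kappa>_sets by auto
    interpret L1_dense_class cylindrical "{\<mu>, \<kappa>}" unit_trig_polys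
      by (rule unit_trig_polys_dense_class) (use measures in auto)
    have ind: "integrable m (indicator B :: ('t \<Rightarrow> real) \<Rightarrow> real)" if "m \<in> {\<mu>, \<kappa>}" for m
      by (rule integrable_unit_range[OF that]) (use B in \<open>auto simp: indicator_def\<close>)
    have bound: "measure \<kappa> B \<le> real K * e + poisson_tail c K + e" if e: "e > 0" for K and e :: real
    proof -
      obtain f where f: "f \<in> unit_trig_polys" "\<forall>m\<in>{\<mu>, \<kappa>}. (\<integral>x. \<bar>f x - indicator B x\<bar> \<partial>m) < e"
        using unit_trig_polys_L1_dense[OF _ measures B e, of "{\<mu>, \<kappa>}"] by auto
      have f_int: "integrable m f" if "m \<in> {\<mu>, \<kappa>}" for m
        by (rule integrable_unit_range[OF that S_measurable[OF f(1)]]) (simp add: S_range[OF f(1)])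
      have diff: "\<bar>(\<integral>x. f x \<partial>m) - measure m B\<bar> < e" if m: "m \<in> {\<mu>, \<kappa>}" for m
      proof -
        have "measure m B = (\<integral>x. indicator B x \<partial>m)"
          using space_eq_UNIV[OF measures(2)[OF m]] by simp
        then have "(\<integral>x. f x \<partial>m) - measure m B = (\<integral>x. f x - indicator B x \<partial>m)"
          by (simp only: Bochner_Integration.integral_diff[OF f_int[OF m] ind[OF m]])
        also have "\<bar>\<dots>\<bar> \<le> (\<integral>x. \<bar>f x - indicator B x\<bar> \<partial>m)" by (rule integral_abs_bound)
        also have "\<dots> < e" using f(2) m by blast
        finally show ?thesis .
      qed
      have "measure \<mu> B = 0" using B_null by (simp add: measure_eq_0_null_sets)
      then have "(\<integral>x. f x \<partial>\<mu>) \<le> e" using diff[of \<mu>] by auto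
      then have "real K * (\<integral>x. f x \<partial>\<mu>) \<le> real K * e" by (rule mult_left_mono) simp
      then show ?thesis using diff[of \<kappa>] le[OF f(1), of K] by auto
    qed
    have "measure \<kappa> B \<le> poisson_tail c K" for K
    proof -
      have "((\<lambda>e. real K * e + poisson_tail c K + e) \<longlongrightarrow> real K * 0 + poisson_tail c K + 0) (at_right 0)"
        by (intro tendsto_intros)
      then have "measure \<kappa> B \<le> real K * 0 + poisson_tail c K + 0"
      proof (rule tendsto_lowerbound)
        show "eventually (\<lambda>e. measure \<kappa> B \<le> real K * e + poisson_tail c K + e) (at_right 0)"
          by (rule eventually_mono[OF eventually_at_right_less bound])
      qed simp
      then show ?thesis by simp
    qed
    then have "measure \<kappa> B \<le> 0" by (intro LIMSEQ_le_const[OF poisson_tail_tendsto_0]) auto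
    then have "measure \<kappa> B = 0" by (simp add: antisym)
    then show "B \<in> null_sets \<kappa>"
      using B \<kappa>_sets finite_measure.emeasure_eq_measure[OF \<kappa>_finite, of B] by (auto simp: null_sets_def)
  qed
qed

text \<open>
  Truncating a density at one changes neither its zero set nor, therefore, the null sets, and
  yields a measure dominated by \<open>\<nu>\<close> itself.
\<close>
lemma finite_measure_bounded_density:
  fixes \<nu> \<rho> :: "'a measure"
  assumes \<nu>: "sigma_finite_measure \<nu>" and \<rho>: "finite_measure \<rho>" "sets \<rho> = sets \<nu>"
    and ac: "absolutely_continuous \<nu> \<rho>"
  obtains h where "integrable \<nu> h" "\<And>x. 0 \<le> h x" "\<And>x. h x \<le> (1::real)"
    "absolutely_continuous (density \<nu> (\<lambda>x. ennreal (h x))) \<rho>"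
proof -
  interpret sigma_finite_measure \<nu> by fact
  obtain g where g [measurable]: "g \<in> borel_measurable \<nu>" and g_\<rho>: "density \<nu> g = \<rho>"
    using Radon_Nikodym[OF ac \<rho>(2)] by blast
  define h where "h x = enn2real (min (g x) 1)" for x
  have h_meas [measurable]: "h \<in> borel_measurable \<nu>" unfolding h_def by measurable
  have h: "ennreal (h x) = min (g x) 1" for x
    unfolding h_def by (rule ennreal_enn2real) (simp add: min_less_iff_disj)
  have h0: "0 \<le> h x" for x unfolding h_def by simp
  have h1: "h x \<le> 1" for x
  proof -
    have "ennreal (h x) \<le> 1" unfolding h by simp
    then show ?thesis by simp
  qed
  have "(\<integral>\<^sup>+x. ennreal (h x) \<partial>\<nu>) \<le> (\<integral>\<^sup>+x. g x \<partial>\<nu>)"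
    unfolding h by (intro nn_integral_mono) simp
  also have "\<dots> = emeasure \<rho> (space \<rho>)" unfolding g_\<rho>[symmetric] by (simp add: emeasure_density)
  also have "\<dots> < \<infinity>" using finite_measure.emeasure_finite[OF \<rho>(1)] by (simp add: less_top)
  finally have int: "integrable \<nu> h" using h0 by (intro integrableI_nonneg) auto
  have "absolutely_continuous (density \<nu> (\<lambda>x. ennreal (h x))) (density \<nu> g)"
    unfolding absolutely_continuous_def
  proof
    fix B assume "B \<in> null_sets (density \<nu> (\<lambda>x. ennreal (h x)))"
    then have "B \<in> sets \<nu>" "AE x in \<nu>. x \<in> B \<longrightarrow> min (g x) 1 = 0"
      by (simp_all add: null_sets_density_iff h)
    moreover have min_0: "min a 1 = 0 \<longleftrightarrow> a = 0" for a :: ennreal by (auto simp: min_def)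
    ultimately have "B \<in> sets \<nu>" "AE x in \<nu>. x \<in> B \<longrightarrow> g x = 0"
      by (simp_all add: min_0)
    then show "B \<in> null_sets (density \<nu> g)" by (simp add: null_sets_density_iff)
  qed
  with int h0 h1 show thesis using that unfolding g_\<rho> by blast
qed

text \<open>
  The positive and the negative parts are transported separately, so that expectations with
  infinite values are covered.
\<close>
lemma expectation_identity_density:
  assumes sets: "sets \<mu> = sets \<kappa>" and \<mu>: "\<mu> = distr M N U" and \<kappa>: "\<kappa> = distr M N V"
    and U [measurable]: "U \<in> measurable M N" and V [measurable]: "V \<in> measurable M N"
    and g [measurable]: "g \<in> borel_measurable N" and g0: "\<And>x. 0 \<le> (g x :: real)"
    and dens: "\<kappa> = density \<mu> (\<lambda>x. ennreal (g x))" and F [measurable]: "F \<in> borel_measurable N"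
  shows "expectation_identity M (\<lambda>\<omega>. F (V \<omega>)) (\<lambda>\<omega>. F (U \<omega>) * g (U \<omega>))"
proof -
  have eq: "(\<integral>\<^sup>+\<omega>. ennreal (G (V \<omega>)) \<partial>M) = (\<integral>\<^sup>+\<omega>. ennreal (G (U \<omega>) * g (U \<omega>)) \<partial>M)"
    if [measurable]: "G \<in> borel_measurable N" for G :: "_ \<Rightarrow> real"
  proof -
    have "(\<integral>\<^sup>+\<omega>. ennreal (G (V \<omega>)) \<partial>M) = (\<integral>\<^sup>+x. ennreal (G x) \<partial>\<kappa>)"
      unfolding \<kappa> by (subst nn_integral_distr) auto
    also have "\<dots> = (\<integral>\<^sup>+x. ennreal (g x) * ennreal (G x) \<partial>\<mu>)"
      unfolding dens by (subst nn_integral_density) (auto simp: \<mu>)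
    also have "\<dots> = (\<integral>\<^sup>+\<omega>. ennreal (g (U \<omega>)) * ennreal (G (U \<omega>)) \<partial>M)"
      unfolding \<mu> by (subst nn_integral_distr) auto
    also have "\<dots> = (\<integral>\<^sup>+\<omega>. ennreal (G (U \<omega>) * g (U \<omega>)) \<partial>M)"
      by (subst ennreal_mult'[OF g0, symmetric]) (simp add: mult.commute)
    finally show ?thesis .
  qed
  have "(\<integral>\<^sup>+\<omega>. ennreal (- F (V \<omega>)) \<partial>M) = (\<integral>\<^sup>+\<omega>. ennreal (- (F (U \<omega>) * g (U \<omega>))) \<partial>M)"
    using eq[of "\<lambda>x. - F x"] by simp
  with eq[OF F] show ?thesis
    unfolding expectation_identity_def expectation_exists_def ext_expectation_def by simp
qed

theorem theorem4p1:
  fixes M :: "'w measure"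
    and X Z :: "'t \<Rightarrow> 'w \<Rightarrow> real"
    and \<nu> :: "('t \<Rightarrow> real) measure"
  assumes "prob_space M"
    and "infinitely_divisible_process M X"
    and "levy_measure_of M X \<nu>"
    and "sigma_finite_measure \<nu>"
    and "process M Z"
    and "prob_space.indep_var M cylindrical (sample_path X) cylindrical (sample_path Z)"
    and "absolutely_continuous \<nu> (law M Z)"
  shows "absolutely_continuous (law M X) (law M (\<lambda>t \<omega>. X t \<omega> + Z t \<omega>)) \<and>
    (\<exists>g \<in> borel_measurable cylindrical. (\<forall>x. g x \<ge> (0::real)) \<and>
      (\<forall>F \<in> borel_measurable cylindrical.
        expectation_identity M
          (\<lambda>\<omega>. F (sample_path (\<lambda>t \<omega>. X t \<omega> + Z t \<omega>) \<omega>))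
          (\<lambda>\<omega>. F (sample_path X \<omega>) * g (sample_path X \<omega>))))"
proof -
  interpret prob_space M by fact
  let ?S = "\<lambda>t \<omega>. X t \<omega> + Z t \<omega>"
  have path: "sample_path Y \<in> measurable M cylindrical" if "process M Y" for Y :: "'t \<Rightarrow> 'w \<Rightarrow> real"
    unfolding sample_path_def[abs_def] using that
    by (intro measurable_PiM_single') (auto simp: process_def space_PiM)
  have X: "process M X" using assms(2) unfolding infinitely_divisible_process_def by simp
  have S: "process M ?S"
    using X assms(5) unfolding process_def by (auto intro: borel_measurable_add)
  have law_prob: "prob_space (law M Y)" and law_sets: "sets (law M Y) = sets cylindrical"
    if "process M Y" for Y :: "'t \<Rightarrow> 'w \<Rightarrow> real"
    unfolding law_def by (simp_all add: prob_space_distr path[OF that])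
  interpret LX: prob_space "law M X" by (rule law_prob[OF X])
  interpret LZ: prob_space "law M Z" by (rule law_prob[OF assms(5)])
  interpret LS: prob_space "law M ?S" by (rule law_prob[OF S])
  have \<nu>: "levy_measure \<nu>" and sets_\<nu>: "sets \<nu> = sets cylindrical"
    using assms(3) unfolding levy_measure_of_def levy_measure_def by simp_all
  have jumps: "integrable \<nu> (\<lambda>x. min (\<bar>x t\<bar>\<^sup>2) 1)" for t
  proof (rule integrableI_nonneg)
    show "(\<lambda>x. min (\<bar>x t\<bar>\<^sup>2) 1) \<in> borel_measurable \<nu>"
      unfolding measurable_cong_sets[OF sets_\<nu> refl] by measurable
    show "(\<integral>\<^sup>+ x. ennreal (min (\<bar>x t\<bar>\<^sup>2) 1) \<partial>\<nu>) < \<infinity>" using \<nu> unfolding levy_measure_def by simp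
  qed simp
  obtain \<Sigma> b where \<Sigma>: "nonneg_definite \<Sigma>" and \<phi>: "\<And>I a. finite I \<Longrightarrow> I \<noteq> {} \<Longrightarrow>
      (LINT \<omega>|M. iexp (\<Sum>t\<in>I. a t * X t \<omega>)) =
          exp (- complex_of_real ((\<Sum>s\<in>I. \<Sum>t\<in>I. a s * a t * \<Sigma> s t) / 2)
             + (LINT x|\<nu>. iexp (\<Sum>t\<in>I. a t * x t) - 1
                  - \<i> * complex_of_real (\<Sum>t\<in>I. a t * x t * indicator {y. \<bar>y\<bar> \<le> 1} (x t)))
             + \<i> * complex_of_real (\<Sum>t\<in>I. a t * b t))"
    using assms(3) unfolding levy_measure_of_def by blast
  have \<phi>': "(\<integral>x. character I a x \<partial>law M X) =
      exp (- complex_of_real ((\<Sum>s\<in>I. \<Sum>t\<in>I. a s * a t * \<Sigma> s t) / 2) +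
        (\<integral>x. levy_integrand I a x \<partial>\<nu>) + \<i> * complex_of_real (\<Sum>t\<in>I. a t * b t))"
    if "finite I" "I \<noteq> {}" for I a
  proof -
    have "(\<integral>x. character I a x \<partial>law M X) = (LINT \<omega>|M. iexp (\<Sum>t\<in>I. a t * X t \<omega>))"
      unfolding law_def integral_distr[OF path[OF X] character_measurable]
      by (simp only: character_def sample_path_def)
    then show ?thesis
      unfolding \<phi>[OF that] levy_integrand_def character_def small_jump_def by (simp only: mult.assoc)
  qed
  obtain h where h: "integrable \<nu> h" "\<And>x. 0 \<le> h x" "\<And>x. h x \<le> 1"
    and ac_h: "absolutely_continuous (density \<nu> (\<lambda>x. ennreal (h x))) (law M Z)"
    using finite_measure_bounded_density[OF assms(4) LZ.finite_measure_axioms _ assms(7)]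
      law_sets[OF assms(5)] sets_\<nu> by metis
  have law_S: "law M ?S = law_convolution (law M X) (law M Z)"
  proof -
    have "law M X \<Otimes>\<^sub>M law M Z =
        distr M (cylindrical \<Otimes>\<^sub>M cylindrical) (\<lambda>\<omega>. (sample_path X \<omega>, sample_path Z \<omega>))"
      unfolding law_def using assms(6) unfolding indep_var_distribution_eq by simp
    then have "law_convolution (law M X) (law M Z) =
        distr M cylindrical ((\<lambda>(x, y) t. x t + y t) \<circ> (\<lambda>\<omega>. (sample_path X \<omega>, sample_path Z \<omega>)))"
      unfolding law_convolution_def
      by (simp only: distr_distr[OF measurable_path_sum[OF refl refl]
            measurable_Pair[OF path[OF X] path[OF assms(5)]]])
    then show ?thesis by (simp add: law_def comp_def sample_path_def[abs_def])
  qed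
  have sf: "sigma_finite_measure (density \<nu> (\<lambda>x. ennreal (h x)))"
    by (rule sigma_finite_measure.sigma_finite_iff_density_finite[THEN iffD2, OF assms(4)]) (use h in auto)
  have "absolutely_continuous (law M X) (law_convolution (law M X) (density \<nu> (\<lambda>x. ennreal (h x))))"
    by (rule absolutely_continuous_convolution_thinned_levy_measure
        [OF law_prob[OF X] law_sets[OF X] sets_\<nu> jumps \<Sigma> \<phi>' h])
  moreover have "absolutely_continuous (law_convolution (law M X) (density \<nu> (\<lambda>x. ennreal (h x))))
      (law_convolution (law M X) (law M Z))"
    by (rule absolutely_continuous_law_convolution[OF LX.sigma_finite_measure_axioms law_sets[OF X] sf _
          LZ.sigma_finite_measure_axioms law_sets[OF assms(5)] ac_h]) (simp add: sets_\<nu>)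
  ultimately have ac: "absolutely_continuous (law M X) (law M ?S)"
    unfolding law_S absolutely_continuous_def by blast
  have sets_eq: "sets (law M ?S) = sets (law M X)" by (simp add: law_sets X S)
  obtain g where g: "g \<in> borel_measurable (law M X)" "\<And>x. 0 \<le> g x"
    and RN: "AE x in law M X. RN_deriv (law M X) (law M ?S) x = ennreal (g x)"
    by (rule LX.real_RN_deriv[OF LS.finite_measure_axioms ac sets_eq], rule that)
  have g_cyl: "g \<in> borel_measurable cylindrical"
    using g(1) unfolding measurable_cong_sets[OF law_sets[OF X] refl] .
  have "law M ?S = density (law M X) (RN_deriv (law M X) (law M ?S))"
    by (rule LX.density_RN_deriv[symmetric, OF ac sets_eq])
  also have "\<dots> = density (law M X) (\<lambda>x. ennreal (g x))"
    by (rule density_cong) (use RN g(1) in auto)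
  finally have dens: "law M ?S = density (law M X) (\<lambda>x. ennreal (g x))" .
  have "expectation_identity M (\<lambda>\<omega>. F (sample_path ?S \<omega>)) (\<lambda>\<omega>. F (sample_path X \<omega>) * g (sample_path X \<omega>))"
    if "F \<in> borel_measurable cylindrical" for F
    by (rule expectation_identity_density[OF _ law_def law_def path[OF X] path[OF S] g_cyl g(2) dens that])
      (simp add: sets_eq)
  with ac g_cyl g(2) show ?thesis by blast
qed

end
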